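(* Assume $x_0\in\mathbb{R}^n$ satisfies $Ax_0=0$. Then the limit $c_0:=\lim_{t\to0^+}t^{-\mathcal N}\det D_t$ exists and is strictly positive, and there are real numbers $a_0=1,a_1,a_2,\dots$ such that for every integer $h\ge 0$ $$p(t,x_0,x_0)=\frac{t^{-\mathcal N/2}}{(2\pi)^{n/2}\sqrt{c_0}}\Big(\sum_{i=0}^{h}a_i t^i+O(t^{h+1})\Big),\qquad t\to0^+.$$ The coefficients $a_i$ do not depend on $x_0$, and there exist universal polynomials $P_i$ of degree $i$ (independent of $n,k,A,B$) such that $$a_i=P_i\big(\mathrm{tr}A,\ \mathrm{tr}\,\mathcal Q^{(0)},\dots,\mathrm{tr}\,\mathcal Q^{(i-2)}\big).$$ In particular $$a_1=-\frac{\mathrm{tr}A}{2},\qquad a_2=\frac{(\mathrm{tr}A)^2}{8}+\frac{\mathrm{tr}\,\mathcal Q^{(0)}}{4},\qquad a_3=-\frac{\mathrm{tr}\,\mathcal Q^{(1)}}{12}-\frac{\mathrm{tr}A\,\mathrm{tr}\,\mathcal Q^{(0)}}{8}-\frac{(\mathrm{tr}A)^3}{48}.$$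
   Context: Let $n\ge1$, $1\le k\le n$, let $A$ be a real $n\times n$ matrix and $B$ a real $n\times k$ matrix of rank $k$. Assume the Kalman condition: there is a minimal integer $m\ge1$ with $\mathrm{rank}[B,AB,\dots,A^{m-1}B]=n$. For $i\ge1$ let $E_i\subset\mathbb{R}^n$ be the span of the columns of $B,AB,\dots,A^{i-1}B$, let $E_0=\{0\}$, $k_i=\dim E_i$, $d_i=k_i-k_{i-1}$, and $\mathcal N:=\sum_{i=1}^m(2i-1)d_i$. For $t\in\mathbb{R}$ put $\Gamma_t:=\int_0^t e^{-\tau A}BB^{T}e^{-\tau A^{T}}\,d\tau$ and $D_t:=e^{tA}\Gamma_te^{tA^{T}}$; these are invertible for $t\neq0$. The heat kernel of the operator $\partial_t-L$, $L=\sum_{j}(Ax)_j\partial_{x_j}+\frac12\sum_{j,h}(BB^{T})_{jh}\partial_{x_j}\partial_{x_h}$, is $$p(t,x,y)=\frac{\exp\!\big(-\tfrac12(y-e^{tA}x)^{T}D_t^{-1}(y-e^{tA}x)\big)}{(2\pi)^{n/2}\sqrt{\det D_t}},\qquad t>0,\ x,y\in\mathbb{R}^n.$$ For $t\ne0$ let $\mathcal Q(t):=-\frac{d}{dt}\big(B^{T}\Gamma_t^{-1}B\big)$, a symmetric $k\times k$ matrix. It is known (and may be assumed) that $t\mapsto t^2\mathcal Q(t)$ extends to a real-analytic function near $t=0$; the symmetric $k\times k$ matrices $\mathcal I$ and $\mathcal Q^{(i)}$, $i\ge0$, are defined by the expansion $\mathcal Q(t)=\frac{1}{t^2}\mathcal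 I+\sum_{i=0}^{h}\mathcal Q^{(i)}t^i+O(t^{h+1})$ for every $h$. (One has $\mathrm{tr}\,\mathcal I=\mathcal N$.) *)

theory Defs
  imports "HOL-Analysis.Analysis" "HOL-Library.Landau_Symbols" "HOL-Library.Poly_Mapping"
    "Jordan_Normal_Form.DL_Rank" "Jordan_Normal_Form.Gauss_Jordan_Elimination"
begin

text \<open>Matrices are Jordan_Normal_Form matrices (type real mat) whose dimensions are
  values, so that the dimensions n, k can be quantified inside the statement
  (needed for the universality of the polynomials P_i).\<close>

definition mexp :: "real mat \<Rightarrow> real mat" where
  "mexp M = mat (dim_row M) (dim_col M)
     (\<lambda>(i,j). suminf (\<lambda>l. (M ^\<^sub>m l) $$ (i,j) / fact l))"

definition mtrace :: "real mat \<Rightarrow> real" where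
  "mtrace M = (\<Sum>i<dim_row M. M $$ (i,i))"

definition mrank :: "real mat \<Rightarrow> nat" where
  "mrank M = vec_space.rank (dim_row M) M"

definition minv :: "real mat \<Rightarrow> real mat" where
  "minv M = the (mat_inverse M)"

text \<open>Kalman matrix [B, AB, ..., A^(i-1) B] (n x (i k)); its column span is E_i.\<close>
definition kalman_mat :: "real mat \<Rightarrow> real mat \<Rightarrow> nat \<Rightarrow> real mat" where
  "kalman_mat A B i = mat (dim_row B) (i * dim_col B)
     (\<lambda>(r,c). ((A ^\<^sub>m (c div dim_col B)) * B) $$ (r, c mod dim_col B))"

definition kdim :: "real mat \<Rightarrow> real mat \<Rightarrow> nat \<Rightarrow> nat" where
  "kdim A B i = (if i = 0 then 0 else mrank (kalman_mat A B i))"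

definition ddim :: "real mat \<Rightarrow> real mat \<Rightarrow> nat \<Rightarrow> nat" where
  "ddim A B i = kdim A B i - kdim A B (i - 1)"

definition kalman_index :: "real mat \<Rightarrow> real mat \<Rightarrow> nat" where
  "kalman_index A B = (LEAST m. 1 \<le> m \<and> mrank (kalman_mat A B m) = dim_row A)"

definition homdim :: "real mat \<Rightarrow> real mat \<Rightarrow> nat" where
  "homdim A B = (\<Sum>i = 1..kalman_index A B. (2 * i - 1) * ddim A B i)"

definition Gamma_int :: "real mat \<Rightarrow> real mat \<Rightarrow> real \<Rightarrow> real mat" where
  "Gamma_int A B t = mat (dim_row A) (dim_row A) (\<lambda>(i,j).
     let f = (\<lambda>\<tau>. (mexp ((-\<tau>) \<cdot>\<^sub>m A) * B * transpose_mat B * mexp ((-\<tau>) \<cdot>\<^sub>m transpose_mat A)) $$ (i,j))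
     in if 0 \<le> t then integral {0..t} f else - integral {t..0} f)"

definition Dmat :: "real mat \<Rightarrow> real mat \<Rightarrow> real \<Rightarrow> real mat" where
  "Dmat A B t = mexp (t \<cdot>\<^sub>m A) * Gamma_int A B t * mexp (t \<cdot>\<^sub>m transpose_mat A)"

definition heat_kernel :: "real mat \<Rightarrow> real mat \<Rightarrow> real \<Rightarrow> real vec \<Rightarrow> real vec \<Rightarrow> real" where
  "heat_kernel A B t x y =
     (let z = y - mexp (t \<cdot>\<^sub>m A) *\<^sub>v x
      in exp (- (1/2) * (z \<bullet> (minv (Dmat A B t) *\<^sub>v z)))
         / ((2 * pi) powr (real (dim_row A) / 2) * sqrt (det (Dmat A B t))))"

definition Qmat :: "real mat \<Rightarrow> real mat \<Rightarrow> real \<Rightarrow> real mat" where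
  "Qmat A B t = mat (dim_col B) (dim_col B) (\<lambda>(i,j).
     - deriv (\<lambda>s. (transpose_mat B * minv (Gamma_int A B s) * B) $$ (i,j)) t)"

definition Q_expansion :: "real mat \<Rightarrow> real mat \<Rightarrow> real mat \<Rightarrow> (nat \<Rightarrow> real mat) \<Rightarrow> bool" where
  "Q_expansion A B Ic Qc \<longleftrightarrow>
     Ic \<in> carrier_mat (dim_col B) (dim_col B) \<and>
     (\<forall>l. Qc l \<in> carrier_mat (dim_col B) (dim_col B)) \<and>
     (\<forall>h. \<forall>i < dim_col B. \<forall>j < dim_col B.
        (\<lambda>t. (Qmat A B t) $$ (i,j) - Ic $$ (i,j) / t^2 - (\<Sum>l\<le>h. (Qc l) $$ (i,j) * t^l))
          \<in> O[at 0](\<lambda>t. t^(h+1)))"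

text \<open>Multivariate real polynomials in variables indexed by nat, as finitely supported
  maps from monomials (exponent vectors) to coefficients.\<close>
type_synonym mpoly = "(nat \<Rightarrow>\<^sub>0 nat) \<Rightarrow>\<^sub>0 real"

definition mpoly_eval :: "mpoly \<Rightarrow> (nat \<Rightarrow> real) \<Rightarrow> real" where
  "mpoly_eval p x = (\<Sum>m\<in>Poly_Mapping.keys p.
     Poly_Mapping.lookup p m * (\<Prod>v\<in>Poly_Mapping.keys m. x v ^ Poly_Mapping.lookup m v))"

definition mpoly_total_degree :: "mpoly \<Rightarrow> nat" where
  "mpoly_total_degree p = Max (insert 0
     ((\<lambda>m. \<Sum>v\<in>Poly_Mapping.keys m. Poly_Mapping.lookup m v) ` Poly_Mapping.keys p))"

definition mpoly_vars :: "mpoly \<Rightarrow> nat set" where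
  "mpoly_vars p = (\<Union>m\<in>Poly_Mapping.keys p. Poly_Mapping.keys m)"

end

theory Submission
  imports Defs
begin

text \<open>Since \<open>D t = - \<Gamma> (- t)\<close>, Jacobi's formula gives \<open>(ln \<bar>det D\<bar>)' = tr (B\<^sup>T (\<Gamma> t)\<^sup>-\<^sup>1 B)\<close> and hence
  \<open>(ln \<bar>det D\<bar>)'' = - tr Q\<close>. The function \<open>det D\<close> is a power series in \<open>t\<close>. In coordinates given by
  the reduced row echelon form of the Kalman matrix, row \<open>r\<close> of \<open>e\<^sup>t\<^sup>A B\<close> is divisible by
  \<open>t ^ (w r - 1)\<close>, where \<open>w r\<close> is the step at which the coordinate \<open>r\<close> enters the flag \<open>E\<^sub>i\<close>, so that
  \<open>det D\<close> is \<open>t ^ N\<close>, with \<open>N\<close> the sum of the \<open>2 * w r - 1\<close>, times a series whose constant term is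
  a positive Gram determinant. On the diagonal at a zero of \<open>A x\<close> the kernel is a constant times the
  inverse square root of \<open>det D\<close>; its expansion follows by integrating \<open>- tr Q\<close> twice. The one missing
  constant of integration is \<open>tr A\<close>, by the identity
  \<open>det (D t) = (- 1) ^ n * exp (2 * t * tr A) * det (D (- t))\<close>.\<close>

section \<open>Multivariate polynomials\<close>

text \<open>The obstacle is that \<open>Gamma_int A B t\<close> is singular at \<open>t = 0\<close>,
  so neither its inverse nor \<open>Qmat\<close> can be expanded there directly. The determinant
  can, since the entries of D are antiderivatives of power series. Its order of vanishing is the
  only singular information: dividing by \<open>t ^ N\<close> leaves a series U with positive
  constant term. The logarithmic derivative of det D is then \<open>N / t\<close> plus the analytic
  function W = U' / U, and every coefficient is read off from W. Of the two constants of
  integration, one is the constant term of W and the other is the factor c0 by which the kernel is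
  normalised. That the trace of \<open>Ic\<close> equals N is an outcome: uniqueness of expansions
  leaves no other double pole. The polynomials have to be chosen before the dimensions and the
  matrices, so they are built formally from the recursion that solves V' = - W V / 2, with one
  independent variable for each coefficient of W.\<close>

definition mono_eval :: "(nat \<Rightarrow>\<^sub>0 nat) \<Rightarrow> (nat \<Rightarrow> real) \<Rightarrow> real" where
  "mono_eval m x = (\<Prod>v\<in>Poly_Mapping.keys m. x v ^ Poly_Mapping.lookup m v)"

definition mono_degree :: "(nat \<Rightarrow>\<^sub>0 nat) \<Rightarrow> nat" where
  "mono_degree m = (\<Sum>v\<in>Poly_Mapping.keys m. Poly_Mapping.lookup m v)"

lemma mono_eval_superset:
  assumes "finite K" "Poly_Mapping.keys m \<subseteq> K"
  shows "mono_eval m x = (\<Prod>v\<in>K. x v ^ Poly_Mapping.lookup m v)"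
  unfolding mono_eval_def
  using assms by (intro prod.mono_neutral_left) (auto simp: in_keys_iff)

lemma mono_degree_superset:
  assumes "finite K" "Poly_Mapping.keys m \<subseteq> K"
  shows "mono_degree m = (\<Sum>v\<in>K. Poly_Mapping.lookup m v)"
  unfolding mono_degree_def
  using assms by (intro sum.mono_neutral_left) (auto simp: in_keys_iff)

lemma mono_eval_plus: "mono_eval (m + m') x = mono_eval m x * mono_eval m' x"
proof -
  let ?K = "Poly_Mapping.keys m \<union> Poly_Mapping.keys m'"
  have "Poly_Mapping.keys (m + m') \<subseteq> ?K" by (rule keys_add)
  then show ?thesis
    by (simp add: mono_eval_superset[where K = ?K] lookup_add power_add prod.distrib)
qed

lemma mono_degree_plus: "mono_degree (m + m') = mono_degree m + mono_degree m'"
proof -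
  let ?K = "Poly_Mapping.keys m \<union> Poly_Mapping.keys m'"
  have "Poly_Mapping.keys (m + m') \<subseteq> ?K" by (rule keys_add)
  then show ?thesis
    by (simp add: mono_degree_superset[where K = ?K] lookup_add sum.distrib)
qed

text \<open>Terms of \<open>p + q\<close> can cancel, so its keys may be fewer than the union of the
  keys of \<open>p\<close> and \<open>q\<close>. Summing over a finite superset, where the extra
  terms are zero, reduces additivity to \<open>lookup_add\<close>.\<close>

lemma mpoly_eval_superset:
  assumes "finite K" "Poly_Mapping.keys p \<subseteq> K"
  shows "mpoly_eval p x = (\<Sum>m\<in>K. Poly_Mapping.lookup p m * mono_eval m x)"
  unfolding mpoly_eval_def mono_eval_def
  using assms by (intro sum.mono_neutral_left) (auto simp: in_keys_iff)

lemma mpoly_eval_plus: "mpoly_eval (p + q) x = mpoly_eval p x + mpoly_eval q x"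
proof -
  let ?K = "Poly_Mapping.keys p \<union> Poly_Mapping.keys q"
  have "Poly_Mapping.keys (p + q) \<subseteq> ?K" by (rule keys_add)
  then show ?thesis
    by (simp add: mpoly_eval_superset[where K = ?K] lookup_add distrib_right sum.distrib)
qed

lemma mpoly_eval_zero [simp]: "mpoly_eval 0 x = 0"
  by (simp add: mpoly_eval_def)

lemma mpoly_eval_one [simp]: "mpoly_eval 1 x = 1"
  by (simp add: mpoly_eval_def)

lemma mpoly_eval_sum: "mpoly_eval (sum p I) x = (\<Sum>i\<in>I. mpoly_eval (p i) x)"
  by (induction I rule: infinite_finite_induct) (auto simp: mpoly_eval_plus)

lemma mpoly_eval_single: "mpoly_eval (Poly_Mapping.single m c) x = c * mono_eval m x"
  by (auto simp: mpoly_eval_def mono_eval_def)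

lemma mpoly_sum_monomials:
  "(p :: mpoly) = (\<Sum>m\<in>Poly_Mapping.keys p. Poly_Mapping.single m (Poly_Mapping.lookup p m))"
proof (rule poly_mapping_eqI)
  fix k
  have "Poly_Mapping.lookup p k =
      (\<Sum>m\<in>Poly_Mapping.keys p. if m = k then Poly_Mapping.lookup p m else 0)"
    by (auto simp: in_keys_iff)
  then show "Poly_Mapping.lookup p k = Poly_Mapping.lookup
      (\<Sum>m\<in>Poly_Mapping.keys p. Poly_Mapping.single m (Poly_Mapping.lookup p m)) k"
    by (simp add: lookup_sum lookup_single when_def)
qed

lemma single_times_mpoly:
  "Poly_Mapping.single m c * (p :: mpoly) =
    (\<Sum>m'\<in>Poly_Mapping.keys p. Poly_Mapping.single (m + m') (c * Poly_Mapping.lookup p m'))"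
  by (subst mpoly_sum_monomials[of p]) (simp only: sum_distrib_left mult_single)

lemma mpoly_eval_single_times:
  "mpoly_eval (Poly_Mapping.single m c * p) x = c * mono_eval m x * mpoly_eval p x"
proof -
  have "mpoly_eval p x = (\<Sum>m\<in>Poly_Mapping.keys p. Poly_Mapping.lookup p m * mono_eval m x)"
    by (rule mpoly_eval_superset) auto
  then show ?thesis
    unfolding single_times_mpoly mpoly_eval_sum mpoly_eval_single mono_eval_plus
    by (simp add: sum_distrib_left algebra_simps)
qed

text \<open>Multiplication by a monomial shifts exponents, and addition of exponents is
  cancellative, so no two terms of \<open>p\<close> are merged.\<close>

lemma lookup_single_times_plus:
  "Poly_Mapping.lookup (Poly_Mapping.single m c * (p :: mpoly)) (m + m') = c * Poly_Mapping.lookup p m'"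
proof -
  have "Poly_Mapping.lookup (Poly_Mapping.single m c * p) (m + m') =
      (\<Sum>k\<in>Poly_Mapping.keys p. if k = m' then c * Poly_Mapping.lookup p k else 0)"
    by (simp add: single_times_mpoly lookup_sum lookup_single when_def)
  then show ?thesis by (auto simp: in_keys_iff)
qed

lemma keys_single_times:
  assumes "k \<in> Poly_Mapping.keys (Poly_Mapping.single m c * (p :: mpoly))"
  obtains m' where "m' \<in> Poly_Mapping.keys p" "k = m + m'"
  using keys_mult[of "Poly_Mapping.single m c" p] assms by (auto split: if_splits)

lemma keys_sum_mpoly:
  "Poly_Mapping.keys (sum (p :: 'i \<Rightarrow> mpoly) I) \<subseteq> (\<Union>i\<in>I. Poly_Mapping.keys (p i))"
proof (induction I rule: infinite_finite_induct)
  case (insert i I)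
  then show ?case using keys_add[of "p i" "sum p I"] by auto
qed auto

text \<open>\<open>log_coeff j * x j\<close> is the coefficient of \<open>t ^ j\<close> in the logarithmic derivative of the
  expansion \<open>\<Sum>i. a i * t ^ i\<close>, where \<open>x 0\<close> stands for the trace of \<open>A\<close> and \<open>x (l + 1)\<close> for the
  trace of the \<open>l\<close>-th coefficient of \<open>Qmat\<close>; the recursion for \<open>heat_poly\<close> is that of an
  exponential of a power series.\<close>
definition log_coeff :: "nat \<Rightarrow> real" where
  "log_coeff j = (if j = 0 then - 1 / 2 else (- 1) ^ (j - 1) / (2 * real j))"

fun heat_poly :: "nat \<Rightarrow> mpoly" where
  "heat_poly 0 = 1"
| "heat_poly (Suc i) = (\<Sum>j\<le>i.
     Poly_Mapping.single (Poly_Mapping.single j 1) (log_coeff j / real (Suc i)) * heat_poly (i - j))"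

declare heat_poly.simps(2) [simp del]

lemma mono_eval_var: "mono_eval (Poly_Mapping.single j 1) x = x j"
  by (simp add: mono_eval_def)

lemma mpoly_eval_heat_poly_Suc:
  "real (Suc i) * mpoly_eval (heat_poly (Suc i)) x =
     (\<Sum>j\<le>i. log_coeff j * x j * mpoly_eval (heat_poly (i - j)) x)"
  by (simp add: heat_poly.simps(2) mpoly_eval_sum mpoly_eval_single_times
      mono_eval_var[unfolded One_nat_def] sum_distrib_left del: of_nat_Suc)

lemma keys_heat_poly_SucE:
  assumes "m \<in> Poly_Mapping.keys (heat_poly (Suc i))"
  obtains j m' where "j \<le> i" "m' \<in> Poly_Mapping.keys (heat_poly (i - j))"
    "m = Poly_Mapping.single j 1 + m'"
proof -
  from assms obtain j where "j \<le> i" "m \<in> Poly_Mapping.keys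
      (Poly_Mapping.single (Poly_Mapping.single j 1) (log_coeff j / real (Suc i)) * heat_poly (i - j))"
    unfolding heat_poly.simps(2) using keys_sum_mpoly by fastforce
  then show ?thesis by (elim keys_single_times) (rule that)
qed

text \<open>If \<open>x j\<close> is given the weight \<open>j + 1\<close>, the recursion produces
  only monomials of weight exactly \<open>i\<close>. Both bounds express this: each factor has
  weight at least 1, and a variable \<open>v\<close> can occur only if
  \<open>v + 1 <= i\<close>.\<close>

lemma keys_heat_poly:
  "m \<in> Poly_Mapping.keys (heat_poly i) \<Longrightarrow> mono_degree m \<le> i \<and> Poly_Mapping.keys m \<subseteq> {..<i}"
proof (induction i arbitrary: m rule: less_induct)
  case (less i)
  show ?case
  proof (cases i)
    case 0
    with less.prems show ?thesis by (auto simp: mono_degree_def)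
  next
    case (Suc i')
    with less.prems obtain j m' where j: "j \<le> i'"
      and m': "m' \<in> Poly_Mapping.keys (heat_poly (i' - j))" and m: "m = Poly_Mapping.single j 1 + m'"
      using keys_heat_poly_SucE by metis
    have IH: "mono_degree m' \<le> i' - j" "Poly_Mapping.keys m' \<subseteq> {..<i' - j}"
      using less.IH[OF _ m'] Suc by auto
    have "mono_degree m = 1 + mono_degree m'"
      unfolding m mono_degree_plus by (simp add: mono_degree_def)
    moreover have "Poly_Mapping.keys m \<subseteq> {j} \<union> Poly_Mapping.keys m'"
      unfolding m using keys_add by fastforce
    ultimately show ?thesis using IH j Suc by fastforce
  qed
qed

text \<open>A pure power of \<open>x 0\<close> can come only from the summand \<open>j = 0\<close>,
  which multiplies by \<open>- 1 / (2 * (i + 1))\<close>. The coefficients are those of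
  \<open>exp (- x 0 / 2)\<close>, never zero, so that the total degree is exactly
  \<open>i\<close>.\<close>

lemma lookup_heat_poly_power:
  "Poly_Mapping.lookup (heat_poly i) (Poly_Mapping.single 0 i) \<noteq> 0"
proof (induction i)
  case (Suc i)
  let ?t = "\<lambda>j. Poly_Mapping.lookup (Poly_Mapping.single (Poly_Mapping.single j 1)
      (log_coeff j / real (Suc i)) * heat_poly (i - j)) (Poly_Mapping.single 0 (Suc i))"
  have zero: "?t j = 0" if "j \<in> {..i} - {0}" for j
  proof (rule ccontr)
    assume "?t j \<noteq> 0"
    then have "Poly_Mapping.single 0 (Suc i) \<in> Poly_Mapping.keys (Poly_Mapping.single
        (Poly_Mapping.single j 1) (log_coeff j / real (Suc i)) * heat_poly (i - j))"
      by (simp add: in_keys_iff)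
    then obtain m' where "Poly_Mapping.single 0 (Suc i) = Poly_Mapping.single j 1 + m'"
      by (rule keys_single_times)
    then have "Poly_Mapping.lookup (Poly_Mapping.single 0 (Suc i)) j =
        Poly_Mapping.lookup (Poly_Mapping.single j 1 + m') j" by simp
    then show False using that by (simp add: lookup_add lookup_single)
  qed
  have "Poly_Mapping.lookup (heat_poly (Suc i)) (Poly_Mapping.single 0 (Suc i)) = (\<Sum>j\<le>i. ?t j)"
    by (simp add: heat_poly.simps(2) lookup_sum)
  also have "\<dots> = ?t 0"
    using zero by (subst sum.remove[of _ 0]) auto
  also have "\<dots> = log_coeff 0 / real (Suc i) * Poly_Mapping.lookup (heat_poly i) (Poly_Mapping.single 0 i)"
    using lookup_single_times_plus[of "Poly_Mapping.single 0 1" "log_coeff 0 / real (Suc i)"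
        "heat_poly i" "Poly_Mapping.single 0 i"]
    by (simp add: single_add[symmetric])
  finally show ?case using Suc by (simp add: log_coeff_def)
qed auto

lemma total_degree_heat_poly: "mpoly_total_degree (heat_poly i) = i"
proof -
  have "mpoly_total_degree (heat_poly i) = Max (insert 0 (mono_degree ` Poly_Mapping.keys (heat_poly i)))"
    by (simp add: mpoly_total_degree_def mono_degree_def[abs_def])
  moreover have "mono_degree (Poly_Mapping.single 0 i) = i"
    by (simp add: mono_degree_def)
  moreover have "Poly_Mapping.single 0 i \<in> Poly_Mapping.keys (heat_poly i)"
    using lookup_heat_poly_power by (simp add: in_keys_iff)
  ultimately show ?thesis
    using keys_heat_poly
    by (intro antisym) (force intro!: Max.boundedI Max_ge simp: image_iff)+
qed

lemma vars_heat_poly: "mpoly_vars (heat_poly i) \<subseteq> {..<i}"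
  using keys_heat_poly by (force simp: mpoly_vars_def)

lemma mpoly_eval_heat_poly_explicit:
  "mpoly_eval (heat_poly 0) x = 1"
  "mpoly_eval (heat_poly 1) x = - x 0 / 2"
  "mpoly_eval (heat_poly 2) x = (x 0)\<^sup>2 / 8 + x 1 / 4"
  "mpoly_eval (heat_poly 3) x = - x 2 / 12 - x 0 * x 1 / 8 - (x 0) ^ 3 / 48"
proof -
  show *: "mpoly_eval (heat_poly 0) x = 1" by simp
  show **: "mpoly_eval (heat_poly 1) x = - x 0 / 2"
    using mpoly_eval_heat_poly_Suc[of 0 x] * by (simp add: log_coeff_def)
  have "{..1::nat} = {0, 1}" by auto
  show ***: "mpoly_eval (heat_poly 2) x = (x 0)\<^sup>2 / 8 + x 1 / 4"
    using mpoly_eval_heat_poly_Suc[of 1 x] * \<open>{..1::nat} = {0, 1}\<close>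
    unfolding One_nat_def[symmetric] Suc_1
    by (simp add: log_coeff_def ** power2_eq_square field_simps del: One_nat_def)
  have "{..2::nat} = {0, 1, 2}" by auto
  then show "mpoly_eval (heat_poly 3) x = - x 2 / 12 - x 0 * x 1 / 8 - (x 0) ^ 3 / 48"
    using mpoly_eval_heat_poly_Suc[of 2 x] *
    by (simp add: log_coeff_def ** **[unfolded One_nat_def] *** power2_eq_square power3_eq_cube field_simps
        del: One_nat_def)
qed

section \<open>Real power series expansions\<close>

text \<open>A geometric bound on the coefficients is easy to carry through integration, reflection
  and recursions. The exponent \<open>Suc n\<close> lets the single constant \<open>K\<close> absorb
  a multiplicative constant as well.\<close>

lemma fps_conv_radius_pos_iff:
  fixes F :: "real fps"
  shows "fps_conv_radius F > 0 \<longleftrightarrow> (\<exists>K. \<forall>n. \<bar>fps_nth F n\<bar> \<le> K ^ Suc n)"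
proof
  assume "fps_conv_radius F > 0"
  then obtain r where r: "0 < r" "ereal r < fps_conv_radius F"
    using ereal_dense2[of 0 "fps_conv_radius F"] by auto
  have "summable (\<lambda>n. fps_nth F n * r ^ n)"
    using r by (intro summable_in_conv_radius) (auto simp: fps_conv_radius_def)
  then have "Bseq (\<lambda>n. fps_nth F n * r ^ n)"
    using summable_LIMSEQ_zero convergentI convergent_imp_Bseq by blast
  then obtain M where M: "\<And>n. \<bar>fps_nth F n * r ^ n\<bar> \<le> M"
    unfolding Bseq_def by auto
  \<comment> \<open>\<open>M\<close> bounds the terms at radius \<open>r\<close>. Both factors of
    \<open>K\<close> are at least 1, so their exponents 1 and \<open>n\<close> may be raised to
    \<open>Suc n\<close>.\<close>
  define K where "K = max M 1 * (1 / r + 1)"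
  have "\<bar>fps_nth F n\<bar> \<le> K ^ Suc n" for n
  proof -
    have "\<bar>fps_nth F n\<bar> = \<bar>fps_nth F n * r ^ n\<bar> * (1 / r) ^ n"
      using r by (simp add: abs_mult power_divide)
    also have "\<dots> \<le> max M 1 * (1 / r + 1) ^ n"
      using r M[of n] by (intro mult_mono power_mono) auto
    also have "\<dots> \<le> max M 1 ^ Suc n * (1 / r + 1) ^ Suc n"
      using r power_increasing[of 1 "Suc n" "max M 1"] power_increasing[of n "Suc n" "1 / r + 1"]
      by (intro mult_mono) auto
    finally show ?thesis by (simp only: K_def power_mult_distrib)
  qed
  then show "\<exists>K. \<forall>n. \<bar>fps_nth F n\<bar> \<le> K ^ Suc n" by blast
next
  assume "\<exists>K. \<forall>n. \<bar>fps_nth F n\<bar> \<le> K ^ Suc n"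
  then obtain K where K: "\<And>n. \<bar>fps_nth F n\<bar> \<le> K ^ Suc n" by blast
  have K0: "K \<ge> 0" using K[of 0] by simp
  \<comment> \<open>\<open>K + 1\<close> guards against \<open>K = 0\<close>; the terms are then
    dominated by a geometric series of ratio 1/2.\<close>
  define r where "r = 1 / (2 * (K + 1))"
  have r: "r > 0" "K * r \<le> 1 / 2" using K0 by (auto simp: r_def field_simps)
  have bound: "norm (fps_nth F n * r ^ n) \<le> K * (1 / 2) ^ n" for n
  proof -
    have "norm (fps_nth F n * r ^ n) \<le> K ^ Suc n * r ^ n"
      using r K[of n] by (auto simp: abs_mult intro!: mult_right_mono)
    also have "\<dots> = K * (K * r) ^ n" by (simp add: power_mult_distrib)
    also have "\<dots> \<le> K * (1 / 2) ^ n" using K0 r by (intro mult_left_mono power_mono) auto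
    finally show ?thesis .
  qed
  have "summable (\<lambda>n. K * (1 / 2) ^ n)" by (intro summable_mult summable_geometric) auto
  then have "summable (\<lambda>n. fps_nth F n * r ^ n)"
    by (rule summable_comparison_test'[where N = 0]) (rule bound)
  then have "ereal (norm r) \<le> fps_conv_radius F"
    unfolding fps_conv_radius_def by (rule conv_radius_geI)
  with r show "fps_conv_radius F > 0"
    by (metis abs_of_pos ereal_less(2) less_le_trans real_norm_def)
qed

lemma fps_conv_radius_integral0_pos:
  fixes F :: "real fps"
  assumes "fps_conv_radius F > 0"
  shows "fps_conv_radius (fps_integral0 F) > 0"
proof -
  from assms obtain K where K: "\<And>n. \<bar>fps_nth F n\<bar> \<le> K ^ Suc n"
    by (auto simp: fps_conv_radius_pos_iff)
  have K0: "K \<ge> 0" using K[of 0] by simp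
  \<comment> \<open>Integration shifts the index by one; the base \<open>K + 1\<close> is at least
    1, so the larger exponent is harmless.\<close>
  have "\<bar>fps_nth (fps_integral0 F) n\<bar> \<le> (K + 1) ^ Suc n" for n
  proof (cases n)
    case (Suc m)
    have "\<bar>fps_nth (fps_integral0 F) n\<bar> \<le> \<bar>fps_nth F m\<bar>"
      by (simp add: Suc fps_integral_def field_simps abs_mult)
    also have "\<dots> \<le> K ^ Suc m" by (rule K)
    also have "\<dots> \<le> (K + 1) ^ Suc m" using K0 by (intro power_mono) auto
    also have "\<dots> \<le> (K + 1) ^ Suc n" using K0 Suc by (intro power_increasing) auto
    finally show ?thesis .
  qed (use K0 in \<open>simp add: fps_integral_def\<close>)
  then show ?thesis by (auto simp: fps_conv_radius_pos_iff)
qed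

lemma has_fps_expansion_antiderivative:
  fixes f g :: "real \<Rightarrow> real"
  assumes "\<forall>\<^sub>F t in nhds 0. (f has_field_derivative g t) (at t)" "f 0 = 0"
    and g: "g has_fps_expansion G"
  shows "f has_fps_expansion fps_integral0 G"
proof -
  let ?I = "fps_integral0 G"
  have rad: "fps_conv_radius ?I > 0"
    using g by (intro fps_conv_radius_integral0_pos) (simp add: has_fps_expansion_def)
  have dI: "fps_deriv ?I = G" by (intro fps_deriv_fps_integral)
  have "\<forall>\<^sub>F t in nhds 0. t \<in> eball 0 (fps_conv_radius ?I)"
    using rad by (intro eventually_nhds_in_open) (auto simp: zero_ereal_def)
  moreover have "\<forall>\<^sub>F t in nhds 0. eval_fps G t = g t"
    using g by (simp add: has_fps_expansion_def)
  ultimately have "\<forall>\<^sub>F t in nhds 0. ((\<lambda>t. f t - eval_fps ?I t) has_field_derivative 0) (at t)"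
    using assms(1)
  proof eventually_elim
    case (elim t)
    have "(eval_fps ?I has_field_derivative eval_fps (fps_deriv ?I) t) (at t)"
      using elim by (intro has_field_derivative_eval_fps) auto
    then show ?case using elim by (auto intro!: derivative_eq_intros simp: dI)
  qed
  then obtain e where e: "e > 0" and
    *: "\<And>t. dist t 0 < e \<Longrightarrow> ((\<lambda>t. f t - eval_fps ?I t) has_field_derivative 0) (at t)"
    unfolding eventually_nhds_metric by blast
  have "f t - eval_fps ?I t = 0" if "dist t 0 < e" for t
  proof -
    have "\<exists>c. \<forall>t\<in>ball 0 e. f t - eval_fps ?I t = c"
      using * by (intro has_field_derivative_zero_constant)
        (auto simp: dist_commute intro: has_field_derivative_at_within)
    then obtain c where c: "\<And>t. t \<in> ball 0 e \<Longrightarrow> f t - eval_fps ?I t = c" by blast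
    have "c = 0" using c[of 0] e assms(2) by (simp add: eval_fps_at_0 fps_integral_def)
    then show ?thesis using c[of t] that by (simp add: dist_commute)
  qed
  then have "\<forall>\<^sub>F t in nhds 0. eval_fps ?I t = f t"
    unfolding eventually_nhds_metric using e by (intro exI[of _ e]) (auto simp: algebra_simps)
  with rad show ?thesis by (simp add: has_fps_expansion_def)
qed

section \<open>Taylor coefficients as limits and their uniqueness\<close>

lemma has_fps_expansion_tendsto_coeff:
  fixes f :: "real \<Rightarrow> real"
  assumes f: "f has_fps_expansion F" and sub: "\<And>i. i < k \<Longrightarrow> fps_nth F i = 0"
  shows "((\<lambda>t. f t / t ^ k) \<longlongrightarrow> fps_nth F k) (at 0)"
\<comment> \<open>As \<open>subdegree 0 = 0\<close>, the zero series need not satisfy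
  \<open>k <= subdegree F\<close>, which shifting requires.\<close>
proof (cases "F = 0")
  case True
  then have "\<forall>\<^sub>F t in nhds 0. f t = 0" using f by (simp add: has_fps_expansion_def)
  then have "\<forall>\<^sub>F t in at 0. f t / t ^ k = 0"
    unfolding eventually_at_filter by eventually_elim auto
  then show ?thesis using True by (simp add: tendsto_eventually)
next
  case False
  then have "k \<le> subdegree F" using sub by (meson nth_subdegree_nonzero not_le)
  then have "(\<lambda>t. if t = 0 then fps_nth F k else f t / t ^ k) has_fps_expansion fps_shift k F"
    by (intro has_fps_expansion_shift f) auto
  then have "isCont (\<lambda>t. if t = 0 then fps_nth F k else f t / t ^ k) 0"
    using has_fps_expansion_imp_continuous by blast
  then have "((\<lambda>t. if t = 0 then fps_nth F k else f t / t ^ k) \<longlongrightarrow> fps_nth F k) (at 0)"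
    by (simp add: isCont_def)
  then show ?thesis
    by (rule Lim_transform_eventually) (auto simp: eventually_at_filter)
qed

lemma has_fps_expansion_remainder:
  fixes f :: "real \<Rightarrow> real"
  assumes f: "f has_fps_expansion F"
  shows "(\<lambda>t. f t - (\<Sum>i\<le>h. fps_nth F i * t ^ i)) has_fps_expansion
     F - (\<Sum>i\<le>h. fps_const (fps_nth F i) * fps_X ^ i)"
  by (intro fps_expansion_intros f)

lemma fps_nth_remainder:
  fixes F :: "real fps" and c :: "nat \<Rightarrow> real"
  assumes "j \<le> h"
  shows "fps_nth (F - (\<Sum>i\<le>h. fps_const (c i) * fps_X ^ i)) j = fps_nth F j - c j"
proof -
  have "(\<Sum>i\<le>h. if j = i then c i else 0) = c j" using assms by simp
  then show ?thesis by (simp add: fps_sum_nth fps_X_power_nth if_distrib[of "(*) _"] cong: if_cong)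
qed

lemma has_fps_expansion_bigo:
  fixes f :: "real \<Rightarrow> real"
  assumes f: "f has_fps_expansion F"
  shows "(\<lambda>t. f t - (\<Sum>i\<le>h. fps_nth F i * t ^ i)) \<in> O[at 0](\<lambda>t. t ^ (h + 1))"
proof (rule bigoI_tendsto)
  show "((\<lambda>t. (f t - (\<Sum>i\<le>h. fps_nth F i * t ^ i)) / t ^ (h + 1)) \<longlongrightarrow>
     fps_nth (F - (\<Sum>i\<le>h. fps_const (fps_nth F i) * fps_X ^ i)) (h + 1)) (at 0)"
  proof (rule has_fps_expansion_tendsto_coeff[OF has_fps_expansion_remainder[OF f]])
    fix i assume "i < h + 1"
    then show "fps_nth (F - (\<Sum>i\<le>h. fps_const (fps_nth F i) * fps_X ^ i)) i = 0"
      by (subst fps_nth_remainder) simp_all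
  qed
  show "\<forall>\<^sub>F t in at 0. t ^ (h + 1) \<noteq> (0::real)"
    by (auto simp: eventually_at_filter)
qed

text \<open>Once the coefficients below \<open>i\<close> vanish, \<open>f t / t ^ i\<close> tends
  both to coefficient \<open>i\<close> and, because \<open>i < m\<close>, to 0.\<close>

lemma fps_nth_eq_0_of_bigo:
  fixes f :: "real \<Rightarrow> real"
  assumes f: "f has_fps_expansion F" and O: "f \<in> O[at 0](\<lambda>t. t ^ m)"
  shows "i < m \<Longrightarrow> fps_nth F i = 0"
proof (induction i rule: less_induct)
  case (less i)
  have "((\<lambda>t. f t / t ^ i) \<longlongrightarrow> fps_nth F i) (at 0)"
    using less by (intro has_fps_expansion_tendsto_coeff f) auto
  moreover have "((\<lambda>t. f t / t ^ i) \<longlongrightarrow> 0) (at 0)"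
  proof -
    obtain C where "\<forall>\<^sub>F t in at 0. norm (f t) \<le> C * norm (t ^ m)"
      using O by (elim landau_o.bigE)
    then have "\<forall>\<^sub>F t in at 0. norm (f t / t ^ i) \<le> norm (C * t ^ (m - i))"
      unfolding eventually_at_filter
    proof eventually_elim
      case (elim t)
      show ?case
      proof (intro impI)
        assume t: "t \<noteq> 0"
        have "norm (f t / t ^ i) \<le> C * norm (t ^ m) / norm (t ^ i)"
          using elim t by (simp add: divide_right_mono)
        also have "\<dots> = C * norm (t ^ (m - i))"
          using t less.prems by (simp add: power_diff abs_mult power_abs)
        also have "\<dots> \<le> norm (C * t ^ (m - i))"
          by (simp add: abs_mult mult_right_mono)
        finally show "norm (f t / t ^ i) \<le> norm (C * t ^ (m - i))" .
      qed
    qed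
    moreover have "((\<lambda>t. norm (C * t ^ (m - i))) \<longlongrightarrow> 0) (at (0::real))"
      using less.prems by (auto intro!: tendsto_eq_intros)
    ultimately show ?thesis by (rule Lim_null_comparison)
  qed
  ultimately show ?case using tendsto_unique trivial_limit_at by blast
qed

text \<open>The pole must vanish: multiplied by \<open>t\<^sup>2\<close>, the estimate for
  \<open>h = 0\<close> makes an analytic function with value \<open>s\<close> at 0 of order
  \<open>t\<^sup>2\<close>. In the application \<open>s\<close> is \<open>N\<close> minus the trace
  of \<open>Ic\<close>.\<close>

lemma laurent_expansion_unique:
  fixes g :: "real \<Rightarrow> real" and q :: "nat \<Rightarrow> real"
  assumes g: "g has_fps_expansion G"
    and O: "\<And>h. (\<lambda>t. g t + s / t\<^sup>2 - (\<Sum>l\<le>h. q l * t ^ l)) \<in> O[at 0](\<lambda>t. t ^ (h + 1))"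
  shows "fps_nth G l = q l"
proof -
  let ?r = "\<lambda>t. g t + s / t\<^sup>2 - q 0"
  have "?r \<in> O[at 0](\<lambda>t. t)" using O[of 0] by simp
  moreover have "(\<lambda>t::real. t) \<in> O[at 0](\<lambda>_. 1)"
    by (intro bigoI_tendsto[where c = 0]) (auto intro!: tendsto_eq_intros)
  ultimately have "?r \<in> O[at 0](\<lambda>_. 1)" by (rule landau_o.big_trans)
  then have "(\<lambda>t. t\<^sup>2 * ?r t) \<in> O[at 0](\<lambda>t. t\<^sup>2 * 1)" by (intro landau_o.big.mult_left)
  moreover have "\<forall>\<^sub>F t in at 0. t\<^sup>2 * ?r t = t\<^sup>2 * g t + s - t\<^sup>2 * q 0"
    by (auto simp: eventually_at_filter algebra_simps)
  ultimately have "(\<lambda>t. t\<^sup>2 * g t + s - t\<^sup>2 * q 0) \<in> O[at 0](\<lambda>t. t ^ 2)"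
    using landau_o.big.in_cong by fastforce
  then have "fps_nth (fps_X ^ 2 * G + fps_const s - fps_X ^ 2 * fps_const (q 0)) 0 = 0"
    by (intro fps_nth_eq_0_of_bigo[of "\<lambda>t. t\<^sup>2 * g t + s - t\<^sup>2 * q 0"] fps_expansion_intros g) auto
  then have s: "s = 0" by simp
  have "(\<lambda>t. g t - (\<Sum>i\<le>l. q i * t ^ i)) has_fps_expansion
      G - (\<Sum>i\<le>l. fps_const (q i) * fps_X ^ i)"
    by (intro fps_expansion_intros g)
  moreover have "(\<lambda>t. g t - (\<Sum>i\<le>l. q i * t ^ i)) \<in> O[at 0](\<lambda>t. t ^ (l + 1))"
    using O[of l] s by simp
  ultimately have "fps_nth (G - (\<Sum>i\<le>l. fps_const (q i) * fps_X ^ i)) l = 0"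
    by (rule fps_nth_eq_0_of_bigo) simp
  then show ?thesis by (subst (asm) fps_nth_remainder) auto
qed

lemma has_fps_expansion_reflect:
  fixes f :: "real \<Rightarrow> real"
  assumes f: "f has_fps_expansion F"
  shows "(\<lambda>t. f (- t)) has_fps_expansion Abs_fps (\<lambda>n. (- 1) ^ n * fps_nth F n)"
proof -
  let ?G = "Abs_fps (\<lambda>n. (- 1) ^ n * fps_nth F n)"
  have "eval_fps ?G t = eval_fps F (- t)" for t
    by (simp add: eval_fps_def mult_ac power_mult_distrib[symmetric])
  moreover have "fps_conv_radius ?G > 0"
    using f by (simp add: has_fps_expansion_def fps_conv_radius_pos_iff abs_mult power_abs)
  moreover have "\<forall>\<^sub>F t in nhds 0. eval_fps F (- t) = f (- t)"
  proof -
    have "filterlim uminus (nhds (- 0)) (nhds (0::real))"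
      by (intro tendsto_minus filterlim_ident)
    then show ?thesis
      using f eventually_compose_filterlim[of "\<lambda>t. eval_fps F t = f t" "nhds 0" uminus "nhds 0"]
      by (simp add: has_fps_expansion_def)
  qed
  ultimately show ?thesis by (simp add: has_fps_expansion_def)
qed

text \<open>The recursion for \<open>a\<close> says that the series \<open>V\<close> with coefficients \<open>a\<close> satisfies
  \<open>V' = - W V / 2\<close>; hence \<open>V\<^sup>2 U\<close> has derivative zero.\<close>
lemma has_fps_expansion_inverse_sqrt:
  fixes U W :: "real fps" and a :: "nat \<Rightarrow> real"
  assumes rad: "fps_conv_radius U > 0" "fps_conv_radius W > 0" and U0: "fps_nth U 0 > 0"
    and WU: "W * U = fps_deriv U" and a0: "a 0 = 1"
    and a_Suc: "\<And>i. real (Suc i) * a (Suc i) = (\<Sum>j\<le>i. - 1 / 2 * fps_nth W j * a (i - j))"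
  shows "(\<lambda>t. sqrt (fps_nth U 0 / eval_fps U t)) has_fps_expansion Abs_fps a"
proof -
  define V where "V = Abs_fps a"
  obtain K where K: "\<And>n. \<bar>fps_nth W n\<bar> \<le> K ^ Suc n"
    using rad(2) by (auto simp: fps_conv_radius_pos_iff)
  have K0: "K \<ge> 0" using K[of 0] by simp
  \<comment> \<open>Each of the \<open>Suc i'\<close> summands is at most \<open>K ^ Suc i'\<close>,
    so their number cancels against the factor on the left of the recursion.\<close>
  have a_bound: "\<bar>a i\<bar> \<le> K ^ i" for i
  proof (induction i rule: less_induct)
    case (less i)
    show ?case
    proof (cases i)
      case (Suc i')
      have "real (Suc i') * \<bar>a (Suc i')\<bar> = \<bar>\<Sum>j\<le>i'. - 1 / 2 * fps_nth W j * a (i' - j)\<bar>"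
        by (subst a_Suc[symmetric]) (simp add: abs_mult)
      also have "\<dots> \<le> (\<Sum>j\<le>i'. \<bar>- 1 / 2 * fps_nth W j * a (i' - j)\<bar>)" by (rule sum_abs)
      also have "\<dots> \<le> (\<Sum>j\<le>i'. K ^ Suc i')"
      proof (rule sum_mono)
        fix j assume j: "j \<in> {..i'}"
        have "\<bar>- 1 / 2 * fps_nth W j * a (i' - j)\<bar> \<le> \<bar>fps_nth W j\<bar> * \<bar>a (i' - j)\<bar>"
          by (simp add: abs_mult)
        also have "\<dots> \<le> K ^ Suc j * K ^ (i' - j)"
          using K[of j] less.IH[of "i' - j"] Suc K0 by (intro mult_mono) auto
        also have "\<dots> = K ^ Suc i'" using j by (simp flip: power_add)
        finally show "\<bar>- 1 / 2 * fps_nth W j * a (i' - j)\<bar> \<le> K ^ Suc i'" .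
      qed
      also have "\<dots> = real (Suc i') * K ^ Suc i'" by simp
      finally show ?thesis using Suc by (simp del: power_Suc)
    qed (simp add: a0)
  qed
  have "\<bar>fps_nth V n\<bar> \<le> (K + 1) ^ Suc n" for n
  proof -
    have "\<bar>fps_nth V n\<bar> \<le> K ^ n" using a_bound by (simp add: V_def)
    also have "\<dots> \<le> (K + 1) ^ n" using K0 by (intro power_mono) auto
    also have "\<dots> \<le> (K + 1) ^ Suc n" using K0 by (intro power_increasing) auto
    finally show ?thesis .
  qed
  then have radV: "fps_conv_radius V > 0" by (auto simp: fps_conv_radius_pos_iff)
  have dV: "fps_deriv V = fps_const (- 1 / 2) * (W * V)"
  proof (rule fps_ext)
    fix i
    show "fps_nth (fps_deriv V) i = fps_nth (fps_const (- 1 / 2) * (W * V)) i"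
      unfolding fps_mult_left_const_nth fps_mult_nth[of W V]
      using a_Suc[of i] by (simp add: V_def atLeast0AtMost sum_distrib_left mult.assoc)
  qed
  \<comment> \<open>Hidden behind a name, the constant is an arbitrary ring element for the
    normalisation; \<open>c + c + 1 = 0\<close> is applied only afterwards.\<close>
  define c :: "real fps" where "c = fps_const (- 1 / 2)"
  have "c + c + 1 = 0" by (rule fps_ext) (simp add: c_def)
  have "fps_deriv (V * V * U) = (c + c + 1) * (W * V * V * U)"
    by (simp add: dV[folded c_def] WU[symmetric] algebra_simps)
  then have "fps_deriv (V ^ 2 * U) = 0"
    unfolding \<open>c + c + 1 = 0\<close> power2_eq_square by (simp only: mult_zero_left)
  then have "V ^ 2 * U = fps_const (fps_nth (V ^ 2 * U) 0)"
    by (simp only: fps_deriv_eq_0_iff)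
  then have VU: "V * V * U = fps_const (fps_nth U 0)"
    by (simp add: power2_eq_square V_def a0)
  have V: "eval_fps V has_fps_expansion V" and U: "eval_fps U has_fps_expansion U"
    using radV rad by (auto intro: eval_fps_has_fps_expansion)
  have "(\<lambda>t. eval_fps V t * eval_fps V t * eval_fps U t) has_fps_expansion V * V * U"
    by (intro fps_expansion_intros U V)
  then have "\<forall>\<^sub>F t in nhds 0. eval_fps V t * eval_fps V t * eval_fps U t = fps_nth U 0"
    unfolding VU by (auto simp: has_fps_expansion_def elim: eventually_mono)
  \<comment> \<open>The equation for \<open>V * V * U\<close> fixes V up to sign; positivity near 0
    selects the positive root.\<close>
  moreover have "\<forall>\<^sub>F t in nhds 0. eval_fps V t > 0"
  proof -
    have "isCont (eval_fps V) 0" using has_fps_expansion_imp_continuous[OF V, of UNIV] by simp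
    then have "(eval_fps V \<longlongrightarrow> eval_fps V 0) (nhds 0)"
      unfolding isCont_def by (simp only: tendsto_at_iff_tendsto_nhds)
    then show ?thesis by (rule order_tendstoD(1)) (simp add: eval_fps_at_0 V_def a0)
  qed
  ultimately have "\<forall>\<^sub>F t in nhds 0. eval_fps V t = sqrt (fps_nth U 0 / eval_fps U t)"
  proof eventually_elim
    case (elim t)
    then have "eval_fps U t \<noteq> 0" using U0 by auto
    then have "fps_nth U 0 / eval_fps U t = (eval_fps V t)\<^sup>2"
      using elim(1) by (simp add: field_simps power2_eq_square)
    then show ?case using elim by simp
  qed
  then show ?thesis using radV by (simp add: has_fps_expansion_def V_def)
qed

section \<open>Matrix-valued functions and the matrix exponential\<close>

text \<open>Matrices of all sizes share one type, so derivatives are taken entry by entry. The size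
  is prescribed at every \<open>s\<close> because the entry formula for products is used as an
  equation between functions of \<open>s\<close>.\<close>

definition has_mat_derivative ::
  "nat \<Rightarrow> nat \<Rightarrow> (real \<Rightarrow> real mat) \<Rightarrow> real mat \<Rightarrow> real \<Rightarrow> bool" where
  "has_mat_derivative nr nc F F' t \<longleftrightarrow>
     (\<forall>s. F s \<in> carrier_mat nr nc) \<and> F' \<in> carrier_mat nr nc \<and>
     (\<forall>i<nr. \<forall>j<nc. ((\<lambda>s. F s $$ (i, j)) has_real_derivative F' $$ (i, j)) (at t))"

lemma has_mat_derivative_const:
  "C \<in> carrier_mat nr nc \<Longrightarrow> has_mat_derivative nr nc (\<lambda>_. C) (0\<^sub>m nr nc) t"
  by (auto simp: has_mat_derivative_def)

lemma index_mult_mat_sum: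
  assumes "A \<in> carrier_mat n m" "B \<in> carrier_mat m k" "i < n" "j < k"
  shows "(A * B) $$ (i, j) = (\<Sum>l<m. A $$ (i, l) * B $$ (l, j))"
  using assms by (simp add: scalar_prod_def atLeast0LessThan)

lemma has_mat_derivative_mult:
  assumes F: "has_mat_derivative n m F F' t" and G: "has_mat_derivative m k G G' t"
  shows "has_mat_derivative n k (\<lambda>s. F s * G s) (F' * G t + F t * G') t"
proof -
  have c: "F s \<in> carrier_mat n m" "F' \<in> carrier_mat n m" "G s \<in> carrier_mat m k"
    "G' \<in> carrier_mat m k" for s
    using F G by (auto simp: has_mat_derivative_def)
  have "((\<lambda>s. (F s * G s) $$ (i, j)) has_real_derivative (F' * G t + F t * G') $$ (i, j)) (at t)"
    if ij: "i < n" "j < k" for i j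
  proof -
    have "((\<lambda>s. \<Sum>l<m. F s $$ (i, l) * G s $$ (l, j)) has_real_derivative
        (\<Sum>l<m. F' $$ (i, l) * G t $$ (l, j) + G' $$ (l, j) * F t $$ (i, l))) (at t)"
      using F G ij by (intro DERIV_sum DERIV_mult) (auto simp: has_mat_derivative_def)
    moreover have "(F' * G t + F t * G') $$ (i, j) =
        (\<Sum>l<m. F' $$ (i, l) * G t $$ (l, j) + G' $$ (l, j) * F t $$ (i, l))"
    proof -
      have "(F' * G t + F t * G') $$ (i, j) = (F' * G t) $$ (i, j) + (F t * G') $$ (i, j)"
        using ij c(1)[of t] c(4) by (subst index_add_mat) auto
      then show ?thesis
        using ij by (simp add: index_mult_mat_sum[OF c(2,3)] index_mult_mat_sum[OF c(1,4)]
            sum.distrib mult.commute del: index_mult_mat)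
    qed
    moreover have "(\<lambda>s. (F s * G s) $$ (i, j)) = (\<lambda>s. \<Sum>l<m. F s $$ (i, l) * G s $$ (l, j))"
      using index_mult_mat_sum[OF c(1,3) ij] by auto
    ultimately show ?thesis by simp
  qed
  moreover have "F s * G s \<in> carrier_mat n k" for s
    by (rule mult_carrier_mat[OF c(1,3)])
  moreover have "F' * G t + F t * G' \<in> carrier_mat n k"
    by (intro add_carrier_mat mult_carrier_mat[OF c(1,4)])
  ultimately show ?thesis unfolding has_mat_derivative_def by blast
qed

lemma has_mat_derivative_mult_const:
  assumes F: "has_mat_derivative n m F F' t" and C: "C \<in> carrier_mat m k"
  shows "has_mat_derivative n k (\<lambda>s. F s * C) (F' * C) t"
proof -
  have "F t \<in> carrier_mat n m" "F' \<in> carrier_mat n m"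
    using F by (auto simp: has_mat_derivative_def)
  then have "F' * C \<in> carrier_mat n k" "F t * 0\<^sub>m m k = 0\<^sub>m n k"
    using C by auto
  then show ?thesis
    using has_mat_derivative_mult[OF F has_mat_derivative_const[OF C]] by simp
qed

lemma has_mat_derivative_const_mult:
  assumes F: "has_mat_derivative m k F F' t" and C: "C \<in> carrier_mat n m"
  shows "has_mat_derivative n k (\<lambda>s. C * F s) (C * F') t"
proof -
  have "F t \<in> carrier_mat m k" "F' \<in> carrier_mat m k"
    using F by (auto simp: has_mat_derivative_def)
  then have "C * F' \<in> carrier_mat n k" "0\<^sub>m n m * F t = 0\<^sub>m n k"
    using C by auto
  then show ?thesis
    using has_mat_derivative_mult[OF has_mat_derivative_const[OF C] F] by simp
qed

lemma has_mat_derivative_transpose: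
  assumes "has_mat_derivative n m F F' t"
  shows "has_mat_derivative m n (\<lambda>s. transpose_mat (F s)) (transpose_mat F') t"
proof -
  have "dim_row (F s) = n" "dim_col (F s) = m" "dim_row F' = n" "dim_col F' = m" for s
    using assms by (auto simp: has_mat_derivative_def)
  then show ?thesis using assms by (auto simp: has_mat_derivative_def)
qed

lemma has_mat_derivative_uminus:
  assumes "has_mat_derivative n m F F' t"
  shows "has_mat_derivative n m (\<lambda>s. - F s) (- F') t"
proof -
  have d: "dim_row (F s) = n" "dim_col (F s) = m" "dim_row F' = n" "dim_col F' = m" for s
    using assms by (auto simp: has_mat_derivative_def)
  have "((\<lambda>s. - F s $$ (i, j)) has_real_derivative - F' $$ (i, j)) (at t)" if "i < n" "j < m" for i j
    using assms that unfolding has_mat_derivative_def by (intro DERIV_minus) blast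
  then show ?thesis
    using assms d by (simp add: has_mat_derivative_def)
qed

lemma has_mat_derivative_add:
  assumes "has_mat_derivative n m F F' t" "has_mat_derivative n m G G' t"
  shows "has_mat_derivative n m (\<lambda>s. F s + G s) (F' + G') t"
proof -
  have d: "dim_row (G s) = n" "dim_col (G s) = m" "dim_row G' = n" "dim_col G' = m" for s
    using assms by (auto simp: has_mat_derivative_def)
  have "((\<lambda>s. F s $$ (i, j) + G s $$ (i, j)) has_real_derivative F' $$ (i, j) + G' $$ (i, j)) (at t)"
    if "i < n" "j < m" for i j
    using assms that unfolding has_mat_derivative_def by (intro DERIV_add) blast+
  then show ?thesis
    using assms d by (simp add: has_mat_derivative_def)
qed

lemma has_mat_derivative_affine:
  assumes "has_mat_derivative n m F F' (c * t + d)"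
  shows "has_mat_derivative n m (\<lambda>s. F (c * s + d)) (c \<cdot>\<^sub>m F') t"
proof -
  have "((\<lambda>s. F (c * s + d) $$ (i, j)) has_real_derivative F' $$ (i, j) * c) (at t)"
    if "i < n" "j < m" for i j
    by (rule DERIV_chain2[where f = "\<lambda>s. F s $$ (i, j)" and g = "\<lambda>s. c * s + d"])
      (use assms that in \<open>auto simp: has_mat_derivative_def intro!: derivative_eq_intros\<close>)
  then show ?thesis using assms by (auto simp: has_mat_derivative_def mult.commute)
qed

lemma has_mat_derivative_zero_const:
  assumes "\<And>t. has_mat_derivative n m F (0\<^sub>m n m) t"
  shows "F s = F t"
proof (rule eq_matI)
  have c: "F u \<in> carrier_mat n m" for u using assms by (auto simp: has_mat_derivative_def)
  fix i j assume "i < dim_row (F t)" "j < dim_col (F t)"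
  then have "i < n" "j < m" using c[of t] by auto
  then have "((\<lambda>s. F s $$ (i, j)) has_real_derivative 0) (at u)" for u
    using assms[of u] by (auto simp: has_mat_derivative_def)
  then show "F s $$ (i, j) = F t $$ (i, j)"
    using DERIV_isconst_all[of "\<lambda>s. F s $$ (i, j)"] by blast
next
  have c: "F u \<in> carrier_mat n m" for u using assms by (auto simp: has_mat_derivative_def)
  show "dim_row (F s) = dim_row (F t)" "dim_col (F s) = dim_col (F t)"
    using c[of s] c[of t] by auto
qed

lemma pow_mat_entry_bound:
  assumes A: "(A :: real mat) \<in> carrier_mat n n"
  obtains K where "K \<ge> 0" "\<And>l i j. i < n \<Longrightarrow> j < n \<Longrightarrow> \<bar>(A ^\<^sub>m l) $$ (i, j)\<bar> \<le> K ^ l"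
proof -
  define M where "M = (\<Sum>i<n. \<Sum>j<n. \<bar>A $$ (i, j)\<bar>)"
  have M0: "M \<ge> 0" by (auto simp: M_def intro!: sum_nonneg)
  have M: "\<bar>A $$ (i, j)\<bar> \<le> M" if "i < n" "j < n" for i j
  proof -
    have "\<bar>A $$ (i, j)\<bar> \<le> (\<Sum>j<n. \<bar>A $$ (i, j)\<bar>)"
      using that by (intro member_le_sum) auto
    also have "\<dots> \<le> M"
      unfolding M_def using that by (intro member_le_sum) (auto intro: sum_nonneg)
    finally show ?thesis .
  qed
  have "\<bar>(A ^\<^sub>m l) $$ (i, j)\<bar> \<le> (n * M) ^ l" if "i < n" "j < n" for l i j
    using that
  proof (induction l arbitrary: i j)
    case (Suc l)
    have Al: "A ^\<^sub>m l \<in> carrier_mat n n" using A by simp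
    have "\<bar>(A ^\<^sub>m Suc l) $$ (i, j)\<bar> = \<bar>\<Sum>a<n. (A ^\<^sub>m l) $$ (i, a) * A $$ (a, j)\<bar>"
      using index_mult_mat_sum[OF Al A] Suc.prems by simp
    also have "\<dots> \<le> (\<Sum>a<n. \<bar>(A ^\<^sub>m l) $$ (i, a) * A $$ (a, j)\<bar>)" by (rule sum_abs)
    also have "\<dots> \<le> (\<Sum>a<n. (n * M) ^ l * M)"
      using Suc M M0 by (intro sum_mono) (auto simp: abs_mult intro!: mult_mono)
    also have "\<dots> = (n * M) ^ Suc l" by simp
    finally show ?case .
  qed (use A in auto)
  moreover have "n * M \<ge> 0" using M0 by simp
  ultimately show ?thesis using that by blast
qed

section \<open>The matrix exponential through the power series of its entries\<close>

definition mexp_fps :: "real mat \<Rightarrow> nat \<Rightarrow> nat \<Rightarrow> real fps" where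
  "mexp_fps A i j = Abs_fps (\<lambda>l. (A ^\<^sub>m l) $$ (i, j) / fact l)"

lemma fps_conv_radius_mexp_fps:
  assumes A: "A \<in> carrier_mat n n" and ij: "i < n" "j < n"
  shows "fps_conv_radius (mexp_fps A i j) = \<infinity>"
  unfolding fps_conv_radius_def
proof (rule conv_radius_inftyI'')
  fix z :: real
  obtain K where K: "K \<ge> 0" "\<And>l. \<bar>(A ^\<^sub>m l) $$ (i, j)\<bar> \<le> K ^ l"
    using pow_mat_entry_bound[OF A] ij by metis
  have "summable (\<lambda>l. (K * \<bar>z\<bar>) ^ l / fact l)"
    using summable_exp[of "K * \<bar>z\<bar>"] by (simp add: field_simps)
  then show "summable (\<lambda>l. fps_nth (mexp_fps A i j) l * z ^ l)"
  proof (rule summable_comparison_test'[where N = 0])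
    fix l
    have "norm (fps_nth (mexp_fps A i j) l * z ^ l) = \<bar>(A ^\<^sub>m l) $$ (i, j)\<bar> * \<bar>z\<bar> ^ l / fact l"
      by (simp add: mexp_fps_def abs_mult power_abs)
    also have "\<dots> \<le> K ^ l * \<bar>z\<bar> ^ l / fact l"
      using K by (intro divide_right_mono mult_right_mono) auto
    finally show "norm (fps_nth (mexp_fps A i j) l * z ^ l) \<le> (K * \<bar>z\<bar>) ^ l / fact l"
      by (simp add: power_mult_distrib)
  qed
qed

lemma pow_mat_smult:
  assumes A: "(A :: real mat) \<in> carrier_mat n n"
  shows "(t \<cdot>\<^sub>m A) ^\<^sub>m l = t ^ l \<cdot>\<^sub>m (A ^\<^sub>m l)"
proof (induction l)
  case (Suc l)
  have Al: "A ^\<^sub>m l \<in> carrier_mat n n" using A by simp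
  have "(t \<cdot>\<^sub>m A) ^\<^sub>m Suc l = (t ^ l \<cdot>\<^sub>m (A ^\<^sub>m l)) * (t \<cdot>\<^sub>m A)" by (simp add: Suc)
  also have "\<dots> = t ^ Suc l \<cdot>\<^sub>m (A ^\<^sub>m Suc l)"
    using A Al by (auto simp: mult_smult_assoc_mat[OF Al, of "t \<cdot>\<^sub>m A" n]
        mult_smult_distrib[OF Al A] intro!: eq_matI)
  finally show ?case .
qed (use A in auto)

lemma dim_mexp [simp]: "dim_row (mexp A) = dim_row A" "dim_col (mexp A) = dim_col A"
  by (simp_all add: mexp_def)

lemma mexp_carrier [simp]: "A \<in> carrier_mat n n \<Longrightarrow> mexp A \<in> carrier_mat n n"
  by (auto simp: mexp_def)

lemma mexp_index:
  assumes A: "A \<in> carrier_mat n n" and ij: "i < n" "j < n"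
  shows "mexp (t \<cdot>\<^sub>m A) $$ (i, j) = eval_fps (mexp_fps A i j) t"
proof -
  have "A ^\<^sub>m l \<in> carrier_mat n n" for l using A by simp
  then have "(t ^ l \<cdot>\<^sub>m (A ^\<^sub>m l)) $$ (i, j) = t ^ l * (A ^\<^sub>m l) $$ (i, j)" for l
    using ij by (metis carrier_matD index_smult_mat(1))
  then show ?thesis
    using A ij by (simp add: mexp_def pow_mat_smult[OF A] eval_fps_def mexp_fps_def mult.commute)
qed

lemma mexp_has_fps_expansion:
  assumes A: "A \<in> carrier_mat n n" and ij: "i < n" "j < n"
  shows "(\<lambda>t. mexp (t \<cdot>\<^sub>m A) $$ (i, j)) has_fps_expansion mexp_fps A i j"
  using eval_fps_has_fps_expansion[of "mexp_fps A i j"]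
  by (simp add: mexp_index[OF assms] fps_conv_radius_mexp_fps[OF assms])

lemma pow_mat_Suc_left:
  assumes "(A :: real mat) \<in> carrier_mat n n"
  shows "A ^\<^sub>m Suc l = A * (A ^\<^sub>m l)"
proof (induction l)
  case (Suc l)
  have "A ^\<^sub>m l \<in> carrier_mat n n" using assms by simp
  then show ?case using assms Suc by (simp add: assoc_mult_mat[of A n n "A ^\<^sub>m l" n A n])
qed (use assms in auto)

lemma mexp_has_derivative:
  assumes A: "A \<in> carrier_mat n n"
  shows "has_mat_derivative n n (\<lambda>t. mexp (t \<cdot>\<^sub>m A)) (A * mexp (t \<cdot>\<^sub>m A)) t" (is ?left)
    and "has_mat_derivative n n (\<lambda>t. mexp (t \<cdot>\<^sub>m A)) (mexp (t \<cdot>\<^sub>m A) * A) t" (is ?right)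
proof -
  have Al: "A ^\<^sub>m l \<in> carrier_mat n n" for l using A by simp
  have E: "mexp (s \<cdot>\<^sub>m A) \<in> carrier_mat n n" for s using A by simp
  have fact: "real (Suc l) * x / fact (Suc l) = x / fact l" for l and x :: real
    by (simp add: field_simps del: of_nat_Suc)
  have inf: "fps_conv_radius (fps_const c * mexp_fps A i j) = \<infinity>" if "i < n" "j < n" for c i j
    using that fps_conv_radius_mexp_fps[OF A] by (cases "c = 0") (auto simp: fps_conv_radius_cmult_left)
  have deriv: "((\<lambda>t. mexp (t \<cdot>\<^sub>m A) $$ (i, j)) has_real_derivative
      eval_fps (fps_deriv (mexp_fps A i j)) t) (at t)" if "i < n" "j < n" for i j
    using has_field_derivative_eval_fps[of t "mexp_fps A i j" UNIV] that
    by (simp add: mexp_index[OF A] fps_conv_radius_mexp_fps[OF A])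
  \<comment> \<open>Evaluation commutes with sums only inside the radii of convergence, so the
    radius is carried through the induction. The index maps \<open>f\<close> and \<open>g\<close>
    let one statement serve for rows and for columns.\<close>
  have sum: "eval_fps (\<Sum>a<m. fps_const (c a) * mexp_fps A (f a) (g a)) t =
      (\<Sum>a<m. c a * mexp (t \<cdot>\<^sub>m A) $$ (f a, g a)) \<and>
      fps_conv_radius (\<Sum>a<m. fps_const (c a) * mexp_fps A (f a) (g a)) = \<infinity>"
    if "\<And>a. a < m \<Longrightarrow> f a < n \<and> g a < n" for f g and c :: "nat \<Rightarrow> real" and m
    using that
  proof (induction m)
    case (Suc m)
    let ?S = "\<Sum>a<m. fps_const (c a) * mexp_fps A (f a) (g a)"
    and ?T = "fps_const (c m) * mexp_fps A (f m) (g m)"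
    have r: "fps_conv_radius ?S = \<infinity>" "fps_conv_radius ?T = \<infinity>"
      "fps_conv_radius (mexp_fps A (f m) (g m)) = \<infinity>"
      using Suc inf fps_conv_radius_mexp_fps[OF A] by auto
    then have "fps_conv_radius (?S + ?T) = \<infinity>"
      using fps_conv_radius_add[of ?S ?T] by (simp add: min_def)
    then show ?case using Suc r by (simp add: eval_fps_add eval_fps_mult mexp_index[OF A])
  qed auto
  have "fps_deriv (mexp_fps A i j) = (\<Sum>a<n. fps_const (A $$ (i, a)) * mexp_fps A a j)"
    if ij: "i < n" "j < n" for i j
  proof (rule fps_ext)
    fix l
    have "(A ^\<^sub>m Suc l) $$ (i, j) = (\<Sum>a<n. A $$ (i, a) * (A ^\<^sub>m l) $$ (a, j))"
      unfolding pow_mat_Suc_left[OF A] by (rule index_mult_mat_sum[OF A Al ij])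
    then show "fps_nth (fps_deriv (mexp_fps A i j)) l =
        fps_nth (\<Sum>a<n. fps_const (A $$ (i, a)) * mexp_fps A a j) l"
      by (simp add: mexp_fps_def fps_sum_nth fact sum_divide_distrib[symmetric]
          del: pow_mat.simps of_nat_Suc fact_Suc)
  qed
  then show ?left
    using A E deriv sum[of n "\<lambda>a. a" "\<lambda>_. _"] index_mult_mat_sum[OF A E]
    unfolding has_mat_derivative_def by (auto simp del: index_mult_mat(1))
  have "fps_deriv (mexp_fps A i j) = (\<Sum>a<n. fps_const (A $$ (a, j)) * mexp_fps A i a)"
    if ij: "i < n" "j < n" for i j
  proof (rule fps_ext)
    fix l
    have "(A ^\<^sub>m Suc l) $$ (i, j) = (\<Sum>a<n. (A ^\<^sub>m l) $$ (i, a) * A $$ (a, j))"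
      by (simp only: pow_mat.simps) (rule index_mult_mat_sum[OF Al A ij])
    then show "fps_nth (fps_deriv (mexp_fps A i j)) l =
        fps_nth (\<Sum>a<n. fps_const (A $$ (a, j)) * mexp_fps A i a) l"
      by (simp add: mexp_fps_def fps_sum_nth fact sum_divide_distrib[symmetric] mult.commute
          del: pow_mat.simps of_nat_Suc fact_Suc)
  qed
  then have "((\<lambda>t. mexp (t \<cdot>\<^sub>m A) $$ (i, j)) has_real_derivative (mexp (t \<cdot>\<^sub>m A) * A) $$ (i, j)) (at t)"
    if ij: "i < n" "j < n" for i j
    using deriv[OF ij] sum[of n "\<lambda>_. i" "\<lambda>a. a" "\<lambda>a. A $$ (a, j)"] ij
    by (simp add: index_mult_mat_sum[OF E A ij] mult.commute del: index_mult_mat(1))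
  then show ?right
    using A E mult_carrier_mat[OF E A] unfolding has_mat_derivative_def by blast
qed

lemma mexp_0:
  assumes A: "A \<in> carrier_mat n n"
  shows "mexp (0 \<cdot>\<^sub>m A) = 1\<^sub>m n"
proof (rule eq_matI)
  fix i j assume "i < dim_row (1\<^sub>m n)" "j < dim_col (1\<^sub>m n)"
  then show "mexp (0 \<cdot>\<^sub>m A) $$ (i, j) = 1\<^sub>m n $$ (i, j)"
    using A mexp_index[OF A, of i j 0] by (simp add: eval_fps_at_0 mexp_fps_def)
qed (use mexp_carrier[of "0 \<cdot>\<^sub>m A" n] A in auto)

text \<open>The left side is constant in \<open>t\<close>: differentiating the first factor in the
  form \<open>E * A\<close> and the second in the form \<open>A * E\<close> puts \<open>A\<close> in
  the middle of both terms, with opposite signs. Inverses are the case \<open>s = 0\<close>, and the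
  group law follows from them.\<close>

lemma mexp_minus_mult_mexp_add:
  assumes A: "A \<in> carrier_mat n n"
  shows "mexp ((- t) \<cdot>\<^sub>m A) * mexp ((t + s) \<cdot>\<^sub>m A) = mexp (s \<cdot>\<^sub>m A)"
proof -
  let ?E = "\<lambda>t. mexp (t \<cdot>\<^sub>m A)"
  have E: "?E t \<in> carrier_mat n n" for t using A by simp
  have "has_mat_derivative n n (\<lambda>t. ?E (- t) * ?E (t + s)) (0\<^sub>m n n) t" for t
  proof -
    have "has_mat_derivative n n (\<lambda>t. ?E (- 1 * t + 0)) (- 1 \<cdot>\<^sub>m (?E (- 1 * t + 0) * A)) t"
      by (intro has_mat_derivative_affine mexp_has_derivative A)
    moreover have "has_mat_derivative n n (\<lambda>t. ?E (1 * t + s)) (1 \<cdot>\<^sub>m (A * ?E (1 * t + s))) t"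
      by (intro has_mat_derivative_affine mexp_has_derivative A)
    ultimately have "has_mat_derivative n n (\<lambda>t. ?E (- t) * ?E (t + s))
       ((- 1 \<cdot>\<^sub>m (?E (- t) * A)) * ?E (t + s) + ?E (- t) * (1 \<cdot>\<^sub>m (A * ?E (t + s)))) t"
      using has_mat_derivative_mult by fastforce
    moreover have "(- 1 \<cdot>\<^sub>m (?E (- t) * A)) * ?E (t + s) + ?E (- t) * (1 \<cdot>\<^sub>m (A * ?E (t + s))) = 0\<^sub>m n n"
    proof -
      have "(- 1 \<cdot>\<^sub>m (?E (- t) * A)) * ?E (t + s) = - 1 \<cdot>\<^sub>m (?E (- t) * A * ?E (t + s))"
        using A E by (intro mult_smult_assoc_mat[of _ n n _ n]) auto
      moreover have "?E (- t) * A * ?E (t + s) = ?E (- t) * (A * ?E (t + s))"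
        using A E by (intro assoc_mult_mat[of _ n n _ n _ n]) auto
      moreover have "1 \<cdot>\<^sub>m (A * ?E (t + s)) = A * ?E (t + s)"
        by (intro eq_matI) auto
      moreover have "?E (- t) * (A * ?E (t + s)) \<in> carrier_mat n n"
        using A E by auto
      moreover have "- 1 \<cdot>\<^sub>m Z + Z = 0\<^sub>m n n" if "Z \<in> carrier_mat n n" for Z :: "real mat"
        using that by (intro eq_matI) auto
      ultimately show ?thesis by simp
    qed
    ultimately show ?thesis by simp
  qed
  from has_mat_derivative_zero_const[OF this, of t 0] show ?thesis
    using left_mult_one_mat[OF E[of s]] by (simp add: mexp_0[OF A])
qed

lemma mexp_minus:
  assumes A: "A \<in> carrier_mat n n"
  shows "mexp ((- t) \<cdot>\<^sub>m A) * mexp (t \<cdot>\<^sub>m A) = 1\<^sub>m n" "mexp (t \<cdot>\<^sub>m A) * mexp ((- t) \<cdot>\<^sub>m A) = 1\<^sub>m n"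
  using mexp_minus_mult_mexp_add[OF A, of t 0] mexp_minus_mult_mexp_add[OF A, of "- t" 0]
  by (simp_all add: mexp_0[OF A])

lemma mexp_add:
  assumes A: "A \<in> carrier_mat n n"
  shows "mexp ((t + s) \<cdot>\<^sub>m A) = mexp (t \<cdot>\<^sub>m A) * mexp (s \<cdot>\<^sub>m A)"
proof -
  let ?E = "\<lambda>t. mexp (t \<cdot>\<^sub>m A)"
  have E: "?E t \<in> carrier_mat n n" for t using A by simp
  have "?E t * ?E s = ?E t * (?E (- t) * ?E (t + s))"
    by (simp only: mexp_minus_mult_mexp_add[OF A])
  also have "\<dots> = ?E t * ?E (- t) * ?E (t + s)"
    by (rule assoc_mult_mat[symmetric, OF E E E])
  also have "\<dots> = ?E (t + s)" by (simp only: mexp_minus[OF A] left_mult_one_mat[OF E])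
  finally show ?thesis by simp
qed

lemma mexp_transpose:
  assumes A: "A \<in> carrier_mat n n"
  shows "mexp (t \<cdot>\<^sub>m transpose_mat A) = transpose_mat (mexp (t \<cdot>\<^sub>m A))"
proof -
  have pow: "transpose_mat A ^\<^sub>m l = transpose_mat (A ^\<^sub>m l)" for l
  proof (induction l)
    case (Suc l)
    have Al: "A ^\<^sub>m l \<in> carrier_mat n n" using A by simp
    have "transpose_mat A ^\<^sub>m Suc l = transpose_mat (A ^\<^sub>m l) * transpose_mat A"
      by (simp add: Suc)
    also have "\<dots> = transpose_mat (A * (A ^\<^sub>m l))" by (rule transpose_mult[OF A Al, symmetric])
    finally show ?case by (simp only: pow_mat_Suc_left[OF A])
  qed (use A in auto)
  have At: "transpose_mat A \<in> carrier_mat n n" using A by simp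
  have Al: "A ^\<^sub>m l \<in> carrier_mat n n" for l using A by simp
  have fps: "mexp_fps (transpose_mat A) i j = mexp_fps A j i" if "i < n" "j < n" for i j
    using that A by (simp add: mexp_fps_def pow)
  show ?thesis
    using A by (intro eq_matI) (auto simp: mexp_index[OF At] mexp_index[OF A] fps)
qed

section \<open>Determinants and the controllability Gramian\<close>

text \<open>Associativity with side conditions on the dimensions of the factors only, so that it can
  serve as a rewrite rule that brackets to the right.\<close>

lemma mult_mat_assoc_dim:
  "dim_col X = dim_row Y \<Longrightarrow> dim_col Y = dim_row Z \<Longrightarrow> X * Y * Z = X * (Y * (Z :: real mat))"
  by (rule assoc_mult_mat[of X "dim_row X" "dim_row Y" Y "dim_row Z" Z "dim_col Z"])
    (auto intro: carrier_matI)

lemma mtrace_mult_commute: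
  assumes X: "X \<in> carrier_mat n m" and Y: "Y \<in> carrier_mat m n"
  shows "mtrace (X * Y) = mtrace (Y * X)"
proof -
  have "mtrace (X * Y) = (\<Sum>i<n. \<Sum>l<m. X $$ (i, l) * Y $$ (l, i))"
    using X by (simp add: mtrace_def index_mult_mat_sum[OF X Y] del: index_mult_mat(1))
  also have "\<dots> = (\<Sum>l<m. \<Sum>i<n. Y $$ (l, i) * X $$ (i, l))"
    by (subst sum.swap) (simp add: mult.commute)
  also have "\<dots> = mtrace (Y * X)"
    using Y by (simp add: mtrace_def index_mult_mat_sum[OF Y X] del: index_mult_mat(1))
  finally show ?thesis .
qed

lemma mtrace_smult: "X \<in> carrier_mat n n \<Longrightarrow> mtrace (c \<cdot>\<^sub>m X) = c * mtrace X"
  by (auto simp: mtrace_def sum_distrib_left)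

text \<open>Jacobi's formula, with the adjugate so that \<open>F t\<close> may be singular. In the
  derivative of the Leibniz sum, the terms that differentiate row \<open>i\<close> form
  \<open>det (R i)\<close>. Since \<open>R i\<close> and \<open>F t\<close> differ in that row
  alone, Laplace expansion along it yields the cofactors of \<open>F t\<close>.\<close>

lemma det_has_derivative:
  assumes F: "has_mat_derivative n n F F' t"
  shows "((\<lambda>s. det (F s)) has_real_derivative mtrace (adj_mat (F t) * F')) (at t)"
proof -
  have c: "F s \<in> carrier_mat n n" "F' \<in> carrier_mat n n" for s
    using F by (auto simp: has_mat_derivative_def)
  let ?P = "{p. p permutes {0..<n}}"
  define R where "R i = mat n n (\<lambda>(a, b). if a = i then F' $$ (a, b) else F t $$ (a, b))" for i
  have R: "R i \<in> carrier_mat n n" for i by (simp add: R_def)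
  have "((\<lambda>s. \<Sum>p\<in>?P. signof p * (\<Prod>i = 0..<n. F s $$ (i, p i))) has_real_derivative
      (\<Sum>p\<in>?P. signof p * (\<Sum>i = 0..<n. F' $$ (i, p i) * (\<Prod>a\<in>{0..<n} - {i}. F t $$ (a, p a))))) (at t)"
  proof (intro DERIV_sum DERIV_cmult has_field_derivative_prod)
    fix p i assume "p \<in> ?P" "i \<in> {0..<n}"
    then show "((\<lambda>s. F s $$ (i, p i)) has_real_derivative F' $$ (i, p i)) (at t)"
      using F permutes_in_image[of p "{0..<n}" i] by (auto simp: has_mat_derivative_def)
  qed
  moreover have "(\<Sum>p\<in>?P. signof p * (\<Sum>i = 0..<n. F' $$ (i, p i) * (\<Prod>a\<in>{0..<n} - {i}. F t $$ (a, p a))))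
      = (\<Sum>i = 0..<n. det (R i))"
  proof -
    have "det (R i) = (\<Sum>p\<in>?P. signof p * (F' $$ (i, p i) * (\<Prod>a\<in>{0..<n} - {i}. F t $$ (a, p a))))"
      if i: "i < n" for i
      unfolding det_def'[OF R]
    proof (intro sum.cong refl arg_cong2[of _ _ _ _ "(*)"])
      fix p assume p: "p \<in> ?P"
      then have "p a < n" if "a < n" for a
        using permutes_in_image[of p "{0..<n}" a] that by auto
      then show "(\<Prod>a = 0..<n. R i $$ (a, p a)) = F' $$ (i, p i) * (\<Prod>a\<in>{0..<n} - {i}. F t $$ (a, p a))"
        using i by (subst prod.remove[of _ i]) (auto simp: R_def intro!: prod.cong)
    qed
    then show ?thesis by (simp add: sum_distrib_left sum.swap[of _ ?P])
  qed
  moreover have "det (R i) = (\<Sum>j<n. F' $$ (i, j) * cofactor (F t) i j)" if i: "i < n" for i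
  proof -
    have "det (R i) = (\<Sum>j<n. R i $$ (i, j) * cofactor (R i) i j)"
      by (rule laplace_expansion_row[OF R i])
    also have "\<dots> = (\<Sum>j<n. F' $$ (i, j) * cofactor (F t) i j)"
    proof (intro sum.cong refl arg_cong2[of _ _ _ _ "(*)"])
      fix j assume j: "j \<in> {..<n}"
      show "R i $$ (i, j) = F' $$ (i, j)" using i j by (simp add: R_def)
      have "mat_delete (R i) i j = mat_delete (F t) i j"
        using c(1)[of t] by (intro eq_matI) (auto simp: mat_delete_def R_def)
      then show "cofactor (R i) i j = cofactor (F t) i j" by (simp add: cofactor_def)
    qed
    finally show ?thesis .
  qed
  moreover have "mtrace (adj_mat (F t) * F') = (\<Sum>i = 0..<n. \<Sum>j<n. F' $$ (i, j) * cofactor (F t) i j)"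
  proof -
    have a: "adj_mat (F t) \<in> carrier_mat n n" using adj_mat(1)[OF c(1)] .
    have adj: "adj_mat (F t) $$ (j, i) = cofactor (F t) i j" if "i < n" "j < n" for i j
      using that c(1)[of t] by (simp add: adj_mat_def)
    have "mtrace (F' * adj_mat (F t)) = (\<Sum>i<n. \<Sum>j<n. F' $$ (i, j) * cofactor (F t) i j)"
      using c(2) by (simp add: mtrace_def index_mult_mat_sum[OF c(2) a] adj del: index_mult_mat(1))
    then show ?thesis
      using mtrace_mult_commute[OF a c(2)] by (simp add: atLeast0LessThan)
  qed
  moreover have "(\<lambda>s. det (F s)) = (\<lambda>s. \<Sum>p\<in>?P. signof p * (\<Prod>i = 0..<n. F s $$ (i, p i)))"
    using det_def'[OF c(1)] by auto
  ultimately show ?thesis by simp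
qed

lemma adj_mat_eq_smult:
  assumes X: "(X :: real mat) \<in> carrier_mat n n" and Y: "Y \<in> carrier_mat n n" and XY: "X * Y = 1\<^sub>m n"
  shows "adj_mat X = det X \<cdot>\<^sub>m Y"
proof -
  note a = adj_mat[OF X]
  have "adj_mat X = adj_mat X * (X * Y)" using a(1) by (simp add: XY)
  also have "\<dots> = det X \<cdot>\<^sub>m 1\<^sub>m n * Y"
    using assoc_mult_mat[OF a(1) X Y] by (simp add: a(3))
  also have "\<dots> = det X \<cdot>\<^sub>m (1\<^sub>m n * Y)" by (rule mult_smult_assoc_mat[of _ n n _ n]) (use Y in auto)
  finally show ?thesis using Y by simp
qed

lemma minv:
  assumes X: "X \<in> carrier_mat n n" and d: "det X \<noteq> 0"
  shows "minv X \<in> carrier_mat n n" "X * minv X = 1\<^sub>m n" "minv X * X = 1\<^sub>m n"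
proof -
  have "X \<in> Units (ring_mat TYPE(real) n ())" by (rule det_non_zero_imp_unit[OF X d])
  then obtain Y where "mat_inverse X = Some Y"
    using mat_inverse(1)[OF X, of "()"] by (cases "mat_inverse X") auto
  then show "minv X \<in> carrier_mat n n" "X * minv X = 1\<^sub>m n" "minv X * X = 1\<^sub>m n"
    using mat_inverse(2)[OF X, of Y] by (auto simp: minv_def)
qed

text \<open>Cramer's rule. It presents the entries of the inverse as quotients of polynomials in the
  entries of \<open>X\<close>, which is how the inverse is differentiated later.\<close>

lemma minv_index:
  assumes X: "X \<in> carrier_mat n n" and d: "det X \<noteq> 0" and ij: "i < n" "j < n"
  shows "minv X $$ (i, j) = cofactor X j i / det X"
proof -
  have "adj_mat X = det X \<cdot>\<^sub>m minv X"
    by (rule adj_mat_eq_smult[OF X]) (use minv[OF X d] in auto)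
  then have "adj_mat X $$ (i, j) = det X * minv X $$ (i, j)"
    using ij minv(1)[OF X d] by simp
  then show ?thesis using X d ij by (simp add: adj_mat_def field_simps)
qed

text \<open>Liouville's formula: by Jacobi's formula the determinant solves
  \<open>y' = mtrace A * y\<close>, so its product with \<open>exp (- t * mtrace A)\<close> is
  constant.\<close>

lemma det_mexp:
  assumes A: "A \<in> carrier_mat n n"
  shows "det (mexp (t \<cdot>\<^sub>m A)) = exp (t * mtrace A)"
proof -
  let ?E = "\<lambda>t. mexp (t \<cdot>\<^sub>m A)"
  have E: "?E t \<in> carrier_mat n n" for t using A by simp
  have d: "((\<lambda>t. det (?E t)) has_real_derivative det (?E t) * mtrace A) (at t)" for t
  proof -
    note a = adj_mat[OF E[of t]]
    have "mtrace (adj_mat (?E t) * (A * ?E t)) = mtrace (A * ?E t * adj_mat (?E t))"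
      using A E a by (intro mtrace_mult_commute[of _ n n]) auto
    also have "A * ?E t * adj_mat (?E t) = A * (?E t * adj_mat (?E t))"
      by (rule assoc_mult_mat[OF A E a(1)])
    also have "\<dots> = det (?E t) \<cdot>\<^sub>m A"
      using mult_smult_distrib[OF A, of "1\<^sub>m n" n] A by (simp add: a(2))
    also have "mtrace \<dots> = det (?E t) * mtrace A" by (rule mtrace_smult[OF A])
    finally show ?thesis
      using det_has_derivative[OF mexp_has_derivative(1)[OF A, of t]] by simp
  qed
  have "((\<lambda>t. det (?E t) * exp (- t * mtrace A)) has_real_derivative 0) (at t)" for t
    using d[of t] by (auto intro!: derivative_eq_intros)
  then have "det (?E t) * exp (- t * mtrace A) = det (?E 0) * exp (- 0 * mtrace A)"
    using DERIV_isconst_all[of "\<lambda>t. det (?E t) * exp (- t * mtrace A)"] by blast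
  then show ?thesis by (simp add: mexp_0[OF A] exp_minus field_simps)
qed

section \<open>The Gramian, its derivative and its reflection in time\<close>

lemma signed_integral_has_real_derivative:
  fixes f :: "real \<Rightarrow> real"
  assumes f: "continuous_on UNIV f"
  shows "((\<lambda>t. if 0 \<le> t then integral {0..t} f else - integral {t..0} f) has_real_derivative f t) (at t)"
proof -
  \<comment> \<open>With this choice \<open>t\<close> is interior to the interval, and both branches
    of the signed integral equal \<open>F x - F 0\<close> for one and the same
    antiderivative.\<close>
  define b where "b = \<bar>t\<bar> + 1"
  define F where "F x = integral {- b..x} f" for x
  have b: "- b < t" "t < b" "0 < b" by (auto simp: b_def)
  have int: "f integrable_on {x..y}" for x y
    using f by (intro integrable_continuous_real continuous_on_subset[OF f]) auto
  have "(F has_real_derivative f t) (at t within {- b..b})"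
    unfolding F_def using b by (intro integral_has_real_derivative continuous_on_subset[OF f]) auto
  then have F: "((\<lambda>x. F x - F 0) has_real_derivative f t) (at t)"
    using b by (auto simp: at_within_Icc_at intro!: derivative_eq_intros)
  show ?thesis
  proof (rule has_field_derivative_transform_within_open[OF F])
    show "open {- b<..<b}" "t \<in> {- b<..<b}" using b by auto
    fix x assume x: "x \<in> {- b<..<b}"
    show "F x - F 0 = (if 0 \<le> x then integral {0..x} f else - integral {x..0} f)"
      using Henstock_Kurzweil_Integration.integral_combine[where a = "- b" and c = 0 and b = x and f = f]
        Henstock_Kurzweil_Integration.integral_combine[where a = "- b" and c = x and b = 0 and f = f] x b int
      by (auto simp: F_def)
  qed
qed

text \<open>At \<open>- t\<close> this is the integrand of \<open>Gamma_int\<close>, with the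
  exponential of the transpose written as a transpose; at \<open>t\<close> it is the derivative of
  \<open>Dmat\<close>.\<close>

definition gram_rate :: "real mat \<Rightarrow> real mat \<Rightarrow> real \<Rightarrow> real mat" where
  "gram_rate A B t = mexp (t \<cdot>\<^sub>m A) * B * transpose_mat B * transpose_mat (mexp (t \<cdot>\<^sub>m A))"

lemma dim_Gamma_int [simp]:
  "dim_row (Gamma_int A B t) = dim_row A" "dim_col (Gamma_int A B t) = dim_row A"
  by (simp_all add: Gamma_int_def)

context
  fixes A B :: "real mat" and n k :: nat
  assumes A: "A \<in> carrier_mat n n" and B: "B \<in> carrier_mat n k"
  notes [simp] = carrier_matD[OF A] carrier_matD[OF B]
begin

lemma gram_rate_carrier: "gram_rate A B t \<in> carrier_mat n n"
  by (intro carrier_matI) (simp_all add: gram_rate_def)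

lemma Gamma_int_carrier: "Gamma_int A B t \<in> carrier_mat n n"
  by (intro carrier_matI) (simp_all add: Gamma_int_def)

lemma Dmat_alt: "Dmat A B t = mexp (t \<cdot>\<^sub>m A) * Gamma_int A B t * transpose_mat (mexp (t \<cdot>\<^sub>m A))"
  by (simp add: Dmat_def mexp_transpose[OF A])

lemma Dmat_carrier: "Dmat A B t \<in> carrier_mat n n"
  by (intro carrier_matI) (simp_all add: Dmat_alt)

lemma gram_rate_continuous:
  assumes "i < n" "j < n"
  shows "continuous_on UNIV (\<lambda>t. gram_rate A B t $$ (i, j))"
proof (intro continuous_at_imp_continuous_on ballI)
  fix t :: real
  have Bt: "transpose_mat B \<in> carrier_mat k n" using B by simp
  note E = mexp_has_derivative(1)[OF A, of t]
  have "\<exists>G'. has_mat_derivative n n (gram_rate A B) G' t"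
    using has_mat_derivative_mult[OF
        has_mat_derivative_mult_const[OF has_mat_derivative_mult_const[OF E B] Bt]
        has_mat_derivative_transpose[OF E]]
    unfolding gram_rate_def[abs_def] by blast
  then show "isCont (\<lambda>t. gram_rate A B t $$ (i, j)) t"
    using assms by (auto simp: has_mat_derivative_def intro: DERIV_isCont)
qed

lemma Gamma_int_has_derivative: "has_mat_derivative n n (Gamma_int A B) (gram_rate A B (- t)) t"
proof -
  have "((\<lambda>s. Gamma_int A B s $$ (i, j)) has_real_derivative gram_rate A B (- t) $$ (i, j)) (at t)"
    if ij: "i < n" "j < n" for i j
  proof -
    have "continuous_on UNIV (\<lambda>\<tau>. gram_rate A B (- \<tau>) $$ (i, j))"
      by (rule continuous_on_compose2[OF gram_rate_continuous[OF ij]]) (auto intro: continuous_intros)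
    from signed_integral_has_real_derivative[OF this, of t, unfolded gram_rate_def] show ?thesis
      using ij by (simp add: Gamma_int_def Let_def gram_rate_def mexp_transpose[OF A]
          del: index_mult_mat(1))
  qed
  then show ?thesis
    using Gamma_int_carrier gram_rate_carrier by (simp add: has_mat_derivative_def)
qed

lemma Gamma_int_0: "Gamma_int A B 0 = 0\<^sub>m n n"
  by (intro eq_matI) (auto simp: Gamma_int_def)

lemma gram_rate_shift:
  "mexp (t \<cdot>\<^sub>m A) * gram_rate A B s * transpose_mat (mexp (t \<cdot>\<^sub>m A)) = gram_rate A B (t + s)"
proof -
  have E: "mexp (t \<cdot>\<^sub>m A) \<in> carrier_mat n n" for t using A by simp
  show ?thesis
    unfolding gram_rate_def mexp_add[OF A] transpose_mult[OF E E]
    by (simp add: mult_mat_assoc_dim)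
qed

text \<open>In \<open>?F u\<close> both terms have opposite derivatives by the semigroup law; compare \<open>u = 0\<close>
  with \<open>u = t\<close>.\<close>
lemma Dmat_eq_Gamma_int: "Dmat A B t = - Gamma_int A B (- t)"
proof -
  let ?E = "mexp (t \<cdot>\<^sub>m A)"
  have E: "?E \<in> carrier_mat n n" using A by simp
  let ?F = "\<lambda>u. ?E * Gamma_int A B u * transpose_mat ?E + - Gamma_int A B (1 * u + - t)"
  have "has_mat_derivative n n ?F (0\<^sub>m n n) u" for u
  proof -
    have "has_mat_derivative n n ?F (?E * gram_rate A B (- u) * transpose_mat ?E +
        - (1 \<cdot>\<^sub>m gram_rate A B (- (1 * u + - t)))) u"
      using E by (intro has_mat_derivative_add has_mat_derivative_uminus has_mat_derivative_affine
          Gamma_int_has_derivative has_mat_derivative_mult_const[where m = n]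
          has_mat_derivative_const_mult[where m = n]) auto
    moreover have "X + - (1 \<cdot>\<^sub>m X) = 0\<^sub>m n n" if "X \<in> carrier_mat n n" for X :: "real mat"
      using that by (intro eq_matI) auto
    moreover have "- (1 * u + - t) = t + - u" by simp
    ultimately show ?thesis
      by (simp only: gram_rate_shift gram_rate_carrier)
  qed
  from has_mat_derivative_zero_const[OF this, of t 0]
  have "?F t = ?F 0" .
  moreover have "?F t = Dmat A B t"
    using Dmat_carrier[of t] by (simp add: Dmat_alt Gamma_int_0)
       (intro eq_matI, auto)
  moreover have "?F 0 = - Gamma_int A B (- t)"
    using E Gamma_int_carrier[of "- t"] by (simp add: Gamma_int_0)
  ultimately show ?thesis by simp
qed

text \<open>The product rule would give the Lyapunov equation, in which D occurs on the right.
  Reading D as a reflected \<open>Gamma_int\<close> gives a derivative free of D, so that D is the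
  antiderivative of a known power series.\<close>

lemma Dmat_has_derivative: "has_mat_derivative n n (Dmat A B) (gram_rate A B t) t"
proof -
  have "has_mat_derivative n n (\<lambda>s. - Gamma_int A B (- 1 * s + 0))
      (- (- 1 \<cdot>\<^sub>m gram_rate A B (- (- 1 * t + 0)))) t"
    by (intro has_mat_derivative_uminus has_mat_derivative_affine Gamma_int_has_derivative)
  moreover have "- (- 1 \<cdot>\<^sub>m X) = X" if "X \<in> carrier_mat n n" for X :: "real mat"
    using that by (intro eq_matI) auto
  ultimately show ?thesis
    using gram_rate_carrier by (simp add: Dmat_eq_Gamma_int[abs_def])
qed

lemma det_Dmat_eq_det_Gamma: "det (Dmat A B t) = exp (2 * t * mtrace A) * det (Gamma_int A B t)"
proof -
  have E: "mexp (t \<cdot>\<^sub>m A) \<in> carrier_mat n n" using A by simp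
  have "det (Dmat A B t) = exp (t * mtrace A) * det (Gamma_int A B t) * exp (t * mtrace A)"
    unfolding Dmat_alt using E Gamma_int_carrier[of t]
    by (simp add: det_mult[of _ n] det_transpose[OF E] det_mexp[OF A])
  then show ?thesis by (simp add: mult_exp_exp mult_ac)
qed

text \<open>D at \<open>t\<close> is congruent to \<open>Gamma_int\<close> at \<open>t\<close>,
  while D at \<open>- t\<close> is its negative. Eliminating the determinant of
  \<open>Gamma_int\<close> relates D to itself.\<close>

lemma det_Dmat_reflect:
  "det (Dmat A B t) = (- 1) ^ n * exp (2 * t * mtrace A) * det (Dmat A B (- t))"
proof -
  have "Dmat A B (- t) = - 1 \<cdot>\<^sub>m Gamma_int A B t"
    unfolding Dmat_eq_Gamma_int by (intro eq_matI) auto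
  then have "det (Dmat A B (- t)) = (- 1) ^ n * det (Gamma_int A B t)" by simp
  then show ?thesis by (simp add: det_Dmat_eq_det_Gamma[of t] flip: mult.assoc power_mult_distrib)
qed

text \<open>In the trace of the inverse of D times \<open>gram_rate\<close>, one pair of
  exponentials cancels at once and the other after a cyclic permutation. What remains is the
  function whose derivative enters \<open>Qmat\<close>.\<close>

lemma det_Dmat_has_derivative:
  assumes "det (Dmat A B t) \<noteq> 0"
  shows "((\<lambda>s. det (Dmat A B s)) has_real_derivative
    det (Dmat A B t) * mtrace (transpose_mat B * minv (Gamma_int A B t) * B)) (at t)"
proof -
  let ?E = "mexp (t \<cdot>\<^sub>m A)" and ?E' = "mexp ((- t) \<cdot>\<^sub>m A)"
  define G where "G = minv (Gamma_int A B t)"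
  have E: "?E \<in> carrier_mat n n" "?E' \<in> carrier_mat n n" using A by auto
  have "det (Gamma_int A B t) \<noteq> 0" using assms by (simp add: det_Dmat_eq_det_Gamma)
  from minv[OF Gamma_int_carrier this]
  have G: "G \<in> carrier_mat n n" "Gamma_int A B t * G = 1\<^sub>m n" by (auto simp: G_def)
  have dG [simp]: "dim_row G = n" "dim_col G = n" using G by auto
  note inv = mexp_minus[OF A, of t]
  have inv': "transpose_mat ?E * transpose_mat ?E' = 1\<^sub>m n"
    using transpose_mult[OF E(2,1)] inv by simp
  define X where "X = transpose_mat ?E' * G * ?E'"
  have X: "X \<in> carrier_mat n n" by (intro carrier_matI) (simp_all add: X_def)
  have "Dmat A B t * X = ?E * (Gamma_int A B t * ((transpose_mat ?E * transpose_mat ?E') * (G * ?E')))"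
    by (simp add: Dmat_alt X_def mult_mat_assoc_dim)
  also have "\<dots> = ?E * ((Gamma_int A B t * G) * ?E')"
    unfolding inv' by (simp add: mult_mat_assoc_dim)
  also have "\<dots> = 1\<^sub>m n" unfolding G(2) using E inv by simp
  finally have adj: "adj_mat (Dmat A B t) = det (Dmat A B t) \<cdot>\<^sub>m X"
    by (rule adj_mat_eq_smult[OF Dmat_carrier X])
  have XG: "X * gram_rate A B t \<in> carrier_mat n n" by (intro carrier_matI) (simp_all add: X_def gram_rate_def)
  have "X * gram_rate A B t =
      transpose_mat ?E' * (G * ((?E' * ?E) * (B * (transpose_mat B * transpose_mat ?E))))"
    by (simp add: X_def gram_rate_def mult_mat_assoc_dim)
  also have "\<dots> = transpose_mat ?E' * (G * (B * (transpose_mat B * transpose_mat ?E)))"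
    unfolding inv using B E by simp
  also have "mtrace \<dots> = mtrace (G * (B * (transpose_mat B * transpose_mat ?E)) * transpose_mat ?E')"
    by (rule mtrace_mult_commute[of _ n n]) (auto intro!: carrier_matI)
  also have "G * (B * (transpose_mat B * transpose_mat ?E)) * transpose_mat ?E' =
      G * (B * (transpose_mat B * (transpose_mat ?E * transpose_mat ?E')))"
    by (simp add: mult_mat_assoc_dim)
  also have "\<dots> = G * B * transpose_mat B"
    unfolding inv' using B by (simp add: mult_mat_assoc_dim)
  also have "mtrace \<dots> = mtrace (transpose_mat B * (G * B))"
    by (rule mtrace_mult_commute[of _ n k]) (auto intro!: carrier_matI)
  finally have "mtrace (X * gram_rate A B t) = mtrace (transpose_mat B * G * B)"
    by (simp add: mult_mat_assoc_dim)
  then have "mtrace (adj_mat (Dmat A B t) * gram_rate A B t) =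
      det (Dmat A B t) * mtrace (transpose_mat B * G * B)"
    by (simp add: adj mult_smult_assoc_mat[OF X gram_rate_carrier] mtrace_smult[OF XG])
  then show ?thesis
    using det_has_derivative[OF Dmat_has_derivative[of t]] by (simp add: G_def)
qed

end

section \<open>Differentiability of the inverse and the trace of \<open>Qmat\<close>\<close>

lemma isCont_eventually_ne:
  fixes f :: "real \<Rightarrow> real"
  assumes "isCont f t" "f t \<noteq> c"
  shows "\<forall>\<^sub>F s in nhds t. f s \<noteq> c"
  using assms tendsto_imp_eventually_ne[of f "f t" "at t" c]
  by (simp add: isCont_def eventually_nhds_conv_at)

lemma has_mat_derivative_mat_delete:
  assumes F: "has_mat_derivative n n F F' t"
  shows "has_mat_derivative (n - 1) (n - 1) (\<lambda>s. mat_delete (F s) i j) (mat_delete F' i j) t"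
proof -
  have c: "dim_row (F s) = n" "dim_col (F s) = n" "dim_row F' = n" "dim_col F' = n" for s
    using F by (auto simp: has_mat_derivative_def)
  show ?thesis
    using F c unfolding has_mat_derivative_def
    by (auto simp: mat_delete_def)
qed

lemma minv_index_differentiable:
  assumes F: "\<And>s. \<exists>F'. has_mat_derivative n n F F' s" and d: "det (F t) \<noteq> 0" and ij: "i < n" "j < n"
  shows "(\<lambda>s. minv (F s) $$ (i, j)) differentiable (at t)"
proof -
  have c: "F s \<in> carrier_mat n n" for s using F by (auto simp: has_mat_derivative_def)
  have det: "\<exists>D. ((\<lambda>s. det (F s)) has_real_derivative D) (at s)" for s
    using F det_has_derivative by blast
  have cof: "\<exists>D. ((\<lambda>s. cofactor (F s) j i) has_real_derivative D) (at t)"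
    unfolding cofactor_def using F[of t] det_has_derivative has_mat_derivative_mat_delete DERIV_cmult
    by metis
  have "isCont (\<lambda>s. det (F s)) t" using det DERIV_isCont by blast
  \<comment> \<open>\<open>minv\<close> is unspecified on singular matrices, so Cramer's rule is
    available only near \<open>t\<close>.\<close>
  then have "\<forall>\<^sub>F s in nhds t. det (F s) \<noteq> 0"
    using d by (rule isCont_eventually_ne)
  then have ev: "\<forall>\<^sub>F s in nhds t. minv (F s) $$ (i, j) = cofactor (F s) j i / det (F s)"
    by eventually_elim (rule minv_index[OF c _ ij])
  obtain D1 D2 where "((\<lambda>s. cofactor (F s) j i) has_real_derivative D1) (at t)"
    "((\<lambda>s. det (F s)) has_real_derivative D2) (at t)" using cof det by blast
  from DERIV_divide[OF this d] show ?thesis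
    unfolding real_differentiable_def using DERIV_cong_ev[OF refl ev refl] by blast
qed

text \<open>\<open>Qmat\<close> is defined through \<open>deriv\<close>, which is informative only
  once differentiability is known. Near \<open>t\<close> a diagonal entry is a fixed linear
  combination of entries of the inverse.\<close>

lemma mtrace_Qmat_derivative:
  assumes A: "A \<in> carrier_mat n n" and B: "B \<in> carrier_mat n k" and d: "det (Gamma_int A B t) \<noteq> 0"
  shows "((\<lambda>s. mtrace (transpose_mat B * minv (Gamma_int A B s) * B)) has_real_derivative
    - mtrace (Qmat A B t)) (at t)"
proof -
  let ?\<beta> = "\<lambda>s. transpose_mat B * minv (Gamma_int A B s) * B"
  let ?\<beta>' = "\<lambda>i s. \<Sum>b<n. (\<Sum>a<n. B $$ (a, i) * minv (Gamma_int A B s) $$ (a, b)) * B $$ (b, i)"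
  have diff: "(\<lambda>s. minv (Gamma_int A B s) $$ (a, b)) differentiable (at t)" if "a < n" "b < n" for a b
    using that d by (intro minv_index_differentiable[of n]) (auto intro: Gamma_int_has_derivative[OF A B])
  have "isCont (\<lambda>s. det (Gamma_int A B s)) t"
    using det_has_derivative[OF Gamma_int_has_derivative[OF A B]] DERIV_isCont by blast
  then have ev: "\<forall>\<^sub>F s in nhds t. det (Gamma_int A B s) \<noteq> 0"
    using d by (rule isCont_eventually_ne)
  have entry: "((\<lambda>s. ?\<beta> s $$ (i, i)) has_real_derivative - Qmat A B t $$ (i, i)) (at t)" if i: "i < k" for i
  proof -
    have "\<forall>\<^sub>F s in nhds t. ?\<beta> s $$ (i, i) = ?\<beta>' i s"
      using ev
    proof eventually_elim
      case (elim s)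
      note G = minv(1)[OF Gamma_int_carrier[OF A B] elim]
      have Bt: "transpose_mat B \<in> carrier_mat k n" using B by simp
      have "transpose_mat B * minv (Gamma_int A B s) \<in> carrier_mat k n" using Bt G by simp
      from index_mult_mat_sum[OF this B i i] show ?case
        using B i by (simp add: index_mult_mat_sum[OF Bt G] del: index_mult_mat(1))
    qed
    from DERIV_cong_ev[OF refl this refl]
    have "(\<lambda>s. ?\<beta> s $$ (i, i)) differentiable (at t) \<longleftrightarrow> ?\<beta>' i differentiable (at t)"
      by (simp only: real_differentiable_def)
    moreover have "?\<beta>' i differentiable (at t)"
      using diff i by (intro differentiable_sum differentiable_mult differentiable_const) auto
    ultimately have "(\<lambda>s. ?\<beta> s $$ (i, i)) differentiable (at t)" by simp
    then show ?thesis
      using B i by (simp add: Qmat_def DERIV_deriv_iff_real_differentiable)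
  qed
  have "mtrace (?\<beta> s) = (\<Sum>i<k. ?\<beta> s $$ (i, i))" for s
    using B by (simp add: mtrace_def)
  moreover have "mtrace (Qmat A B t) = (\<Sum>i<k. Qmat A B t $$ (i, i))"
    using B by (simp add: mtrace_def Qmat_def)
  moreover have "((\<lambda>s. \<Sum>i<k. ?\<beta> s $$ (i, i)) has_real_derivative (\<Sum>i<k. - Qmat A B t $$ (i, i))) (at t)"
    by (intro DERIV_sum entry) auto
  ultimately show ?thesis by (simp add: sum_negf)
qed

section \<open>Echelon form of the Kalman matrix\<close>

lemma kalman_mat_carrier:
  assumes "A \<in> carrier_mat n n" "B \<in> carrier_mat n k"
  shows "kalman_mat A B i \<in> carrier_mat n (i * k)"
  using assms by (auto simp: kalman_mat_def)

lemma kalman_mat_index: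
  assumes "A \<in> carrier_mat n n" "B \<in> carrier_mat n k" "r < n" "c < i * k"
  shows "kalman_mat A B i $$ (r, c) = ((A ^\<^sub>m (c div k)) * B) $$ (r, c mod k)"
  using assms by (auto simp: kalman_mat_def)

lemma col_kalman_mat:
  assumes "A \<in> carrier_mat n n" "B \<in> carrier_mat n k" "c < i * k" "i \<le> m"
  shows "col (kalman_mat A B i) c = col (kalman_mat A B m) c"
proof -
  have "c < m * k" using assms(3,4) by (meson less_le_trans mult_le_mono1)
  then show ?thesis
    using assms kalman_mat_carrier[OF assms(1,2), of i] kalman_mat_carrier[OF assms(1,2), of m]
    by (intro eq_vecI) (auto simp: kalman_mat_index)
qed

text \<open>The columns of the inverse of \<open>P\<close> belonging to the pivots left of \<open>N'\<close> occur among the first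
  \<open>N'\<close> columns of \<open>K\<close> and span all of them.\<close>
lemma pivot_fun_rank:
  assumes K: "(K :: real mat) \<in> carrier_mat n N" and K': "K' \<in> carrier_mat n N'" and N': "N' \<le> N"
    and cols: "\<And>c. c < N' \<Longrightarrow> col K' c = col K c"
    and P: "P \<in> carrier_mat n n" and Q: "Q \<in> carrier_mat n n"
    and PQ: "P * Q = 1\<^sub>m n" and QP: "Q * P = 1\<^sub>m n"
    and piv: "pivot_fun (P * K) p N"
  shows "mrank K' = card {r. r < n \<and> p r < N'}"
proof -
  interpret vec_space "TYPE(real)" n .
  define C where "C = P * K"
  have C: "C \<in> carrier_mat n N" using P K by (simp add: C_def)
  have KQC: "K = Q * C"
    using P Q K QP by (simp add: C_def assoc_mult_mat[symmetric])
  note pD = pivot_funD[OF _ piv, folded C_def, of n]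
  \<comment> \<open>A zero row of \<open>C\<close> has its pivot at \<open>N\<close>, so it is never
    counted.\<close>
  define R where "R = {r. r < n \<and> p r < N'}"
  \<comment> \<open>In reduced echelon form a pivot column is a unit vector, and \<open>Q\<close>
    maps it to one of its own columns.\<close>
  have col_pivot: "col K (p r) = col Q r" if r: "r \<in> R" for r
  proof -
    have pr: "r < n" "p r < N" using r N' by (auto simp: R_def)
    have "col C (p r) = unit_vec n r"
      using pD(4)[of r] pD(5)[of r] C pr by (intro eq_vecI) (auto simp: unit_vec_def)
    moreover have "Q *\<^sub>v unit_vec n r = col Q r"
      using Q pr by (intro eq_vecI) auto
    ultimately show ?thesis
      using col_mult2[OF Q C pr(2)] by (simp only: KQC)
  qed
  have dist: "distinct (cols Q)"
  proof -
    have "r = s" if "r < n" "s < n" "col Q r = col Q s" for r s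
    proof -
      have "unit_vec n r = P *\<^sub>v col Q r" "unit_vec n s = P *\<^sub>v col Q s"
        using col_mult2[OF P Q \<open>r < n\<close>] col_mult2[OF P Q \<open>s < n\<close>] that
        by (simp_all add: PQ)
      then have "unit_vec n r = (unit_vec n s :: real vec)" using that(3) by simp
      then show ?thesis using that(1,2) by simp
    qed
    then show ?thesis using Q by (auto simp: distinct_conv_nth cols_def)
  qed
  have "lin_indpt (set (cols Q))"
  proof
    assume "lin_dep (set (cols Q))"
    then obtain v where v: "v \<in> carrier_vec n" "v \<noteq> 0\<^sub>v n" "Q *\<^sub>v v = 0\<^sub>v n"
      using lin_depE[OF Q _ dist] by blast
    have "v = P * Q *\<^sub>v v" using v by (simp add: PQ)
    also have "\<dots> = P *\<^sub>v 0\<^sub>v n" using v P Q by (simp add: assoc_mult_mat_vec[of P n n Q n])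
    also have "\<dots> = 0\<^sub>v n" using P by (intro eq_vecI) auto
    finally show False using v by simp
  qed
  define U where "U = col Q ` R"
  have UQ: "U \<subseteq> set (cols Q)" using Q by (auto simp: U_def R_def cols_def)
  have Qc: "set (cols Q) \<subseteq> carrier_vec n" using Q by (auto simp: cols_def)
  have indU: "lin_indpt U"
    using \<open>lin_indpt (set (cols Q))\<close> UQ subset_li_is_li by blast
  have UK: "U \<subseteq> set (cols K')"
  proof
    fix x assume "x \<in> U"
    then obtain r where r: "r \<in> R" "x = col Q r" by (auto simp: U_def)
    then have "x = col K' (p r)" using col_pivot cols by (auto simp: R_def)
    then show "x \<in> set (cols K')" using r K' by (auto simp: R_def cols_def)
  qed
  have span: "x \<in> span U" if x_in: "x \<in> set (cols K')" for x
  proof -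
    obtain c where c: "c < N'" "x = col K' c" using x_in K' by (auto simp: cols_def)
    \<comment> \<open>The coefficients of \<open>lincomb\<close> are indexed by vectors;
      \<open>find_first\<close> recovers the number of a column, as the columns of \<open>Q\<close>
      are distinct.\<close>
    define a where "a = (\<lambda>y. col C c $ find_first y (cols Q))"
    have "col K c = Q *\<^sub>v col C c"
      unfolding KQC using c N' by (intro col_mult2[OF Q C]) simp
    then have x: "x = Q *\<^sub>v col C c" using c cols by simp
    also have "\<dots> = lincomb a (set (cols Q))"
      unfolding a_def using C by (intro lincomb_eq_mat_mult[OF Q _ dist, symmetric]) auto
    also have "\<dots> = lincomb a U"
    proof (rule eq_vecI)
      fix i assume "i < dim_vec (lincomb a U)"
      then have i: "i < n" using lincomb_dim UQ Qc by (metis finite_subset List.finite_set subset_trans)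
      have "(\<Sum>y\<in>set (cols Q). a y * y $ i) = (\<Sum>y\<in>U. a y * y $ i)"
      proof (intro sum.mono_neutral_right ballI)
        fix y assume "y \<in> set (cols Q) - U"
        then have "y \<in> col Q ` {..<n}" "y \<notin> col Q ` R" using Q by (auto simp: U_def cols_def)
        then obtain r where r: "r < n" "y = col Q r" "r \<notin> R" by blast
        have "find_first y (cols Q) = r"
          using r Q dist find_first_unique[of "cols Q" r] by auto
        \<comment> \<open>Here \<open>c < N' <= p r\<close>, so the entry lies to the left of the
          pivot of row \<open>r\<close>.\<close>
        moreover have "col C c $ r = 0"
          using r c N' C pD(2)[of r c] by (auto simp: R_def)
        ultimately show "a y * y $ i = 0" by (simp add: a_def)
      qed (use UQ in auto)
      then show "lincomb a (set (cols Q)) $ i = lincomb a U $ i"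
        using i UQ Qc by (simp add: lincomb_index subset_trans[OF UQ Qc])
    qed (use UQ Qc lincomb_dim in \<open>metis finite_subset List.finite_set subset_trans\<close>)
    finally show ?thesis
      unfolding span_def using UQ finite_subset[OF UQ] by auto
  qed
  have K'c: "set (cols K') \<subseteq> carrier_vec n" using K' by (auto simp: cols_def)
  have "maximal U (\<lambda>T. T \<subseteq> set (cols K') \<and> lin_indpt T)"
    unfolding maximal_def
  proof (intro conjI allI impI UK indU)
    fix T assume T: "U \<subseteq> T \<and> T \<subseteq> set (cols K') \<and> lin_indpt T"
    show "T = U"
    proof (rule ccontr)
      assume "T \<noteq> U"
      then obtain x where x: "x \<in> T" "x \<notin> U" using T by blast
      have "lin_dep (U \<union> {x})"
        using lin_dep_iff_in_span[of U x] span x T UK K'c indU by blast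
      moreover have "lin_indpt (U \<union> {x})"
        using T x subset_li_is_li[of T "U \<union> {x}"] by blast
      ultimately show False by blast
    qed
  qed
  then have "rank K' = card U" by (rule rank_card_indpt[OF K'])
  also have "card U = card R"
    unfolding U_def
  proof (rule card_image, rule inj_onI)
    fix r s assume "r \<in> R" "s \<in> R" "col Q r = col Q s"
    then show "r = s"
      using dist Q by (auto simp: distinct_conv_nth cols_def R_def)
  qed
  finally show ?thesis using K' by (simp add: mrank_def R_def)
qed

text \<open>\<open>S\<close> brings the Kalman matrix to reduced row echelon form. The weight \<open>w r\<close> of row \<open>r\<close> is one
  plus the index of the block \<open>A\<^sup>l B\<close> containing its pivot, and \<open>c r\<close> is the position of the pivot
  inside that block.\<close>
lemma kalman_adapted_basis:
  assumes A: "A \<in> carrier_mat n n" and B: "B \<in> carrier_mat n k" and k: "1 \<le> k"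
    and kalman: "\<exists>m\<ge>1. mrank (kalman_mat A B m) = n"
  obtains S w c where "S \<in> carrier_mat n n" "det S \<noteq> 0"
    and "\<And>r. r < n \<Longrightarrow> 1 \<le> w r" and "\<And>r. r < n \<Longrightarrow> c r < k"
    and "\<And>r l j. r < n \<Longrightarrow> l < w r - 1 \<Longrightarrow> j < k \<Longrightarrow> (S * ((A ^\<^sub>m l) * B)) $$ (r, j) = 0"
    and "\<And>r r'. r < n \<Longrightarrow> r' < n \<Longrightarrow>
           (S * ((A ^\<^sub>m (w r - 1)) * B)) $$ (r', c r) = (if r' = r then 1 else 0)"
    and "homdim A B = (\<Sum>r<n. 2 * w r - 1)"
proof -
  define m where "m = kalman_index A B"
  have m: "1 \<le> m" "mrank (kalman_mat A B m) = n"
    using LeastI_ex[of "\<lambda>m. 1 \<le> m \<and> mrank (kalman_mat A B m) = n"] kalman A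
    by (auto simp: m_def kalman_index_def)
  define K where "K = kalman_mat A B m"
  have K: "K \<in> carrier_mat n (m * k)" unfolding K_def by (rule kalman_mat_carrier[OF A B])
  define C where "C = gauss_jordan_single K"
  note gj = gauss_jordan_single[OF K C_def[symmetric]]
  obtain P Q where PQ: "C = P * K" "P \<in> carrier_mat n n" "Q \<in> carrier_mat n n"
    "P * Q = 1\<^sub>m n" "Q * P = 1\<^sub>m n" using gj(4) by blast
  obtain p where p: "pivot_fun C p (m * k)"
    using gj(2,3) by (auto simp: row_echelon_form_def)
  have rank: "mrank (kalman_mat A B i) = card {r. r < n \<and> p r < i * k}" if "i \<le> m" for i
    using that PQ p
    by (intro pivot_fun_rank[OF K kalman_mat_carrier[OF A B]])
      (auto simp: K_def intro!: col_kalman_mat[OF A B])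
  \<comment> \<open>Full rank leaves no zero row, so each row has a genuine pivot and a weight of at
    most \<open>m\<close>.\<close>
  have "{r. r < n \<and> p r < m * k} = {..<n}"
    using rank[of m] m by (intro card_subset_eq) auto
  then have p_less: "p r < m * k" if "r < n" for r using that by blast
  define w where "w r = p r div k + 1" for r
  have w_le: "p r < i * k \<longleftrightarrow> w r \<le> i" for r i
    using k by (auto simp: w_def div_less_iff_less_mult Suc_le_eq)
  have C_index: "(P * ((A ^\<^sub>m l) * B)) $$ (r, j) = C $$ (r, l * k + j)"
    if "r < n" "l < m" "j < k" for r l j
  proof -
    have "l * k + j < l * k + k" using that by simp
    also have "\<dots> \<le> m * k" using that(2) by (metis Suc_leI add.commute mult_Suc mult_le_mono1)
    finally have less: "l * k + j < m * k" .
    have Al: "A ^\<^sub>m l \<in> carrier_mat n n" using A by simp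
    have "col K (l * k + j) = col ((A ^\<^sub>m l) * B) j"
      unfolding K_def using that less A B Al kalman_mat_carrier[OF A B, of m]
      by (intro eq_vecI) (auto simp: kalman_mat_index[OF A B] simp del: index_mult_mat(1))
    then show ?thesis using that less PQ K A B by (simp add: PQ(1))
  qed
  note pD = pivot_funD[OF _ p, of n]
  have Cn: "dim_row C = n" using gj(2) by simp
  \<comment> \<open>Weights are at least 1, so for \<open>i = 0\<close> the set is empty, in
    agreement with the convention in \<open>kdim\<close>.\<close>
  have kdim: "kdim A B i = card {r. r < n \<and> w r \<le> i}" if "i \<le> m" for i
    using rank[OF that] by (auto simp: kdim_def w_le w_def)
  have ddim: "ddim A B i = card {r. r < n \<and> w r = i}" if "i \<in> {1..m}" for i
  proof -
    have "{r. r < n \<and> w r \<le> i} = {r. r < n \<and> w r \<le> i - 1} \<union> {r. r < n \<and> w r = i}"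
      using that by auto
    then have "card {r. r < n \<and> w r \<le> i} = card ({r. r < n \<and> w r \<le> i - 1} \<union> {r. r < n \<and> w r = i})"
      by simp
    also have "\<dots> = card {r. r < n \<and> w r \<le> i - 1} + card {r. r < n \<and> w r = i}"
      using that by (intro card_Un_disjoint) auto
    finally have "card {r. r < n \<and> w r \<le> i} =
        card {r. r < n \<and> w r \<le> i - 1} + card {r. r < n \<and> w r = i}" .
    moreover have "kdim A B (i - 1) = card {r. r < n \<and> w r \<le> i - 1}" "kdim A B i = card {r. r < n \<and> w r \<le> i}"
      using that by (auto intro!: kdim)
    ultimately show ?thesis by (simp add: ddim_def)
  qed
  have "homdim A B = (\<Sum>i = 1..m. (2 * i - 1) * card {r. r < n \<and> w r = i})"
    unfolding homdim_def m_def[symmetric] by (intro sum.cong refl) (simp add: ddim)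
  also have "\<dots> = (\<Sum>i = 1..m. \<Sum>r<n. if w r = i then 2 * i - 1 else 0)"
    by (intro sum.cong refl) (simp add: sum.If_cases Int_def lessThan_def)
  also have "\<dots> = (\<Sum>r<n. \<Sum>i = 1..m. if w r = i then 2 * i - 1 else 0)"
    by (rule sum.swap)
  also have "\<dots> = (\<Sum>r<n. 2 * w r - 1)"
  proof (intro sum.cong refl)
    fix r assume "r \<in> {..<n}"
    then have "w r \<in> {1..m}" using p_less w_le[of r m] by (simp add: w_def)
    then show "(\<Sum>i = 1..m. if w r = i then 2 * i - 1 else 0) = 2 * w r - 1" by simp
  qed
  finally have hom: "homdim A B = (\<Sum>r<n. 2 * w r - 1)" .
  show ?thesis
  proof (rule that[of P w "\<lambda>r. p r mod k"])
    show "det P \<noteq> 0"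
      using PQ(2-4) det_mult[of P n Q] by auto
    show "(P * ((A ^\<^sub>m l) * B)) $$ (r, j) = 0" if "r < n" "l < w r - 1" "j < k" for r l j
    proof -
      have l: "l < p r div k" using that by (simp add: w_def)
      have "l * k + j < Suc l * k" using that by simp
      also have "\<dots> \<le> p r div k * k" using l by (intro mult_le_mono1) simp
      also have "\<dots> \<le> p r" by simp
      finally have "l * k + j < p r" .
      moreover have "l < m"
        using l p_less[OF \<open>r < n\<close>] k less_mult_imp_div_less[of "p r" m k] by linarith
      ultimately show ?thesis using that Cn by (simp add: C_index pD(2))
    qed
    show "(P * ((A ^\<^sub>m (w r - 1)) * B)) $$ (r', p r mod k) = (if r' = r then 1 else 0)"
      if "r < n" "r' < n" for r r'
    proof -
      have "w r - 1 < m" using p_less[OF \<open>r < n\<close>] w_le[of r m] by (simp add: w_def)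
      then show ?thesis
        using that k Cn p_less pD(4)[of r] pD(5)[of r r'] C_index[of r' "w r - 1" "p r mod k"]
        by (auto simp: w_def)
    qed
  qed (use PQ k hom in \<open>auto simp: w_def\<close>)
qed

section \<open>Leading term of the determinant\<close>

text \<open>The determinant does not vanish on the segment joining the identity to \<open>Z\<close>.\<close>
lemma det_pos_if_pos_def:
  assumes Z: "(Z :: real mat) \<in> carrier_mat n n"
    and pos: "\<And>v. v \<in> carrier_vec n \<Longrightarrow> v \<noteq> 0\<^sub>v n \<Longrightarrow>
        0 < (\<Sum>i<n. \<Sum>j<n. v $ i * v $ j * Z $$ (i, j))"
  shows "det Z > 0"
proof (rule ccontr)
  assume neg: "\<not> det Z > 0"
  define Y where "Y s = mat n n (\<lambda>(i, j). (1 - s) * (if i = j then 1 else 0) + s * Z $$ (i, j))" for s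
  have Y: "Y s \<in> carrier_mat n n" for s by (simp add: Y_def)
  have perm: "p i < n" if "p permutes {0..<n}" "i < n" for p i
    using permutes_in_image[OF that(1), of i] that(2) by simp
  have "continuous_on {0..1} (\<lambda>s. det (Y s))"
    unfolding det_def'[OF Y]
  proof (intro continuous_on_sum continuous_on_mult continuous_on_const continuous_on_prod)
    fix p i assume "p \<in> {p. p permutes {0..<n}}" "i \<in> {0..<n}"
    then show "continuous_on {0..1} (\<lambda>s. Y s $$ (i, p i))"
      using perm[of p i] by (auto simp: Y_def intro!: continuous_intros)
  qed
  moreover have "Y 0 = 1\<^sub>m n" "Y 1 = Z" using Z by (auto simp: Y_def intro!: eq_matI)
  ultimately obtain s where s: "0 \<le> s" "s \<le> 1" "det (Y s) = 0"
    using IVT2'[of "\<lambda>s. det (Y s)" 1 0 0] neg by auto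
  then obtain v where v: "v \<in> carrier_vec n" "v \<noteq> 0\<^sub>v n" "Y s *\<^sub>v v = 0\<^sub>v n"
    using det_0_iff_vec_prod_zero[OF Y] by blast
  have "(\<Sum>j<n. Y s $$ (i, j) * v $ j) = 0" if "i < n" for i
  proof -
    have "(Y s *\<^sub>v v) $ i = (\<Sum>j<n. Y s $$ (i, j) * v $ j)"
      using Y[of s] v(1) that by (simp add: scalar_prod_def atLeast0LessThan)
    then show ?thesis using v that by simp
  qed
  \<comment> \<open>Pairing \<open>Y s *\<^sub>v v = 0\<close> with \<open>v\<close> gives a convex
    combination of the squared norm of \<open>v\<close> and the quadratic form of \<open>Z\<close>,
    both positive.\<close>
  then have "0 = (\<Sum>i<n. v $ i * (\<Sum>j<n. Y s $$ (i, j) * v $ j))" by simp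
  also have "\<dots> = (\<Sum>i<n. \<Sum>j<n. (1 - s) * (if i = j then v $ i * v $ i else 0) +
      s * (v $ i * v $ j * Z $$ (i, j)))"
    unfolding sum_distrib_left by (intro sum.cong refl) (auto simp: Y_def algebra_simps)
  also have "\<dots> = (1 - s) * (\<Sum>i<n. v $ i * v $ i) + s * (\<Sum>i<n. \<Sum>j<n. v $ i * v $ j * Z $$ (i, j))"
    by (simp add: sum.distrib flip: sum_distrib_left)
  finally have zero: "(1 - s) * (\<Sum>i<n. v $ i * v $ i) + s * (\<Sum>i<n. \<Sum>j<n. v $ i * v $ j * Z $$ (i, j)) = 0"
    by simp
  obtain i where i: "i < n" "v $ i \<noteq> 0"
    using v(1,2) by (metis carrier_vecD eq_vecI index_zero_vec)
  have "0 < v $ i * v $ i" using i by (simp add: zero_less_mult_iff) linarith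
  also have "\<dots> \<le> (\<Sum>i<n. v $ i * v $ i)" using i by (intro member_le_sum) auto
  finally have "0 < (\<Sum>i<n. v $ i * v $ i)" .
  moreover have "0 < (\<Sum>i<n. \<Sum>j<n. v $ i * v $ j * Z $$ (i, j))" by (rule pos[OF v(1,2)])
  ultimately show False
    using zero s(1,2)
    by (cases "s = 0") (auto simp: add_nonneg_eq_0_iff mult_nonneg_nonneg)
qed

lemma has_integral_power_0_1: "((\<lambda>s. s ^ m) has_integral (1 / real (Suc m))) {0..1::real}"
proof -
  have *: "((\<lambda>s. s ^ Suc m / real (Suc m)) has_vector_derivative s ^ m) (at s within {0..1})" for s :: real
    unfolding has_real_derivative_iff_has_vector_derivative[symmetric]
    by (rule derivative_eq_intros refl | simp)+
  have "((\<lambda>s. s ^ m) has_integral (1 ^ Suc m / real (Suc m) - 0 ^ Suc m / real (Suc m))) {0..1::real}"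
    by (rule fundamental_theorem_of_calculus[OF _ *]) auto
  then show ?thesis by simp
qed

text \<open>The matrix is the Gram matrix, in the square-integrable functions on the unit interval, of the
  polynomial rows \<open>h r j * s ^ (w r - 1)\<close>.\<close>
lemma det_weighted_gram_pos:
  fixes h :: "nat \<Rightarrow> nat \<Rightarrow> real" and w c :: "nat \<Rightarrow> nat"
  assumes w: "\<And>r. r < n \<Longrightarrow> 1 \<le> w r" and c: "\<And>r. r < n \<Longrightarrow> c r < k"
    and h_diag: "\<And>r. r < n \<Longrightarrow> h r (c r) \<noteq> 0"
    and h_off: "\<And>r r'. r < n \<Longrightarrow> r' < n \<Longrightarrow> r' \<noteq> r \<Longrightarrow> w r' = w r \<Longrightarrow> h r' (c r) = 0"
  shows "det (mat n n (\<lambda>(r, r'). (\<Sum>j<k. h r j * h r' j) / real (w r + w r' - 1))) > 0"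
proof (rule det_pos_if_pos_def)
  show "mat n n (\<lambda>(r, r'). (\<Sum>j<k. h r j * h r' j) / real (w r + w r' - 1)) \<in> carrier_mat n n"
    by simp
  fix v :: "real vec" assume v: "v \<in> carrier_vec n" "v \<noteq> 0\<^sub>v n"
  \<comment> \<open>Component \<open>j\<close> of the combination of the polynomial rows with
    coefficients \<open>v\<close>; the quadratic form is the integral of the sum of the squares of
    these components.\<close>
  define g where "g j = (\<Sum>r<n. monom (v $ r * h r j) (w r - 1))" for j
  have g: "poly (g j) s = (\<Sum>r<n. v $ r * h r j * s ^ (w r - 1))" for j s
    by (simp add: g_def poly_sum poly_monom)
  have int: "((\<lambda>s. (poly (g j) s)\<^sup>2) has_integral
      (\<Sum>r<n. \<Sum>r'<n. v $ r * v $ r' * (h r j * h r' j / real (w r + w r' - 1)))) {0..1}" for j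
  proof -
    have "((\<lambda>s. \<Sum>r<n. \<Sum>r'<n. v $ r * v $ r' * (h r j * h r' j) * s ^ (w r + w r' - 2)) has_integral
      (\<Sum>r<n. \<Sum>r'<n. v $ r * v $ r' * (h r j * h r' j / real (w r + w r' - 1)))) {0..1}"
    proof (intro has_integral_sum finite_lessThan)
      fix r r' assume r: "r \<in> {..<n}" "r' \<in> {..<n}"
      have "((\<lambda>s. s ^ (w r + w r' - 2)) has_integral (1 / real (w r + w r' - 1))) {0..1::real}"
      proof -
        have "Suc (w r + w r' - 2) = w r + w r' - 1" using w[of r] w[of r'] r by auto
        then show ?thesis using has_integral_power_0_1[of "w r + w r' - 2"] by simp
      qed
      from has_integral_mult_right[OF this, of "v $ r * v $ r' * (h r j * h r' j)"]
      show "((\<lambda>s. v $ r * v $ r' * (h r j * h r' j) * s ^ (w r + w r' - 2)) has_integral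
          v $ r * v $ r' * (h r j * h r' j / real (w r + w r' - 1))) {0..1}" by simp
    qed
    moreover have "(poly (g j) s)\<^sup>2 =
        (\<Sum>r<n. \<Sum>r'<n. v $ r * v $ r' * (h r j * h r' j) * s ^ (w r + w r' - 2))" for s
      unfolding g power2_eq_square sum_product
    proof (intro sum.cong refl)
      fix r r' assume r: "r \<in> {..<n}" "r' \<in> {..<n}"
      have "(w r - 1) + (w r' - 1) = w r + w r' - 2" using w[of r] w[of r'] r by auto
      then have "s ^ (w r - 1) * s ^ (w r' - 1) = s ^ (w r + w r' - 2)"
        by (simp add: power_add[symmetric])
      then show "v $ r * h r j * s ^ (w r - 1) * (v $ r' * h r' j * s ^ (w r' - 1)) =
          v $ r * v $ r' * (h r j * h r' j) * s ^ (w r + w r' - 2)"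
        by (simp only: \<open>s ^ (w r - 1) * s ^ (w r' - 1) = s ^ (w r + w r' - 2)\<close>[symmetric] mult_ac)
    qed
    ultimately show ?thesis by simp
  qed
  let ?I = "\<lambda>j. integral {0..1} (\<lambda>s. (poly (g j) s)\<^sup>2)"
  have "(\<Sum>r<n. \<Sum>r'<n. v $ r * v $ r' * mat n n (\<lambda>(r, r'). (\<Sum>j<k. h r j * h r' j) /
      real (w r + w r' - 1)) $$ (r, r')) =
      (\<Sum>r<n. \<Sum>r'<n. \<Sum>j<k. v $ r * v $ r' * (h r j * h r' j / real (w r + w r' - 1)))"
    by (intro sum.cong refl) (simp add: sum_distrib_left sum_divide_distrib)
  also have "\<dots> = (\<Sum>j<k. \<Sum>r<n. \<Sum>r'<n. v $ r * v $ r' * (h r j * h r' j / real (w r + w r' - 1)))"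
    by (simp add: sum.swap[of _ "{..<k}"])
  also have "\<dots> = (\<Sum>j<k. ?I j)"
    by (intro sum.cong refl) (rule integral_unique[OF int, symmetric])
  also have "\<dots> > 0"
  proof -
    obtain r where r: "r < n" "v $ r \<noteq> 0"
      using v by (metis carrier_vecD eq_vecI index_zero_vec)
    \<comment> \<open>Rows of another weight contribute in another degree, and the other rows of the
      same weight vanish at position \<open>c r\<close>. Hence this coefficient sees only
      \<open>v $ r\<close>.\<close>
    have "coeff (g (c r)) (w r - 1) = (\<Sum>r'<n. if r' = r then v $ r * h r (c r) else 0)"
      unfolding g_def coeff_sum coeff_monom
    proof (intro sum.cong refl)
      fix r' assume "r' \<in> {..<n}"
      then show "(if w r' - 1 = w r - 1 then v $ r' * h r' (c r) else 0) =
          (if r' = r then v $ r * h r (c r) else 0)"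
        using h_off[of r r'] w[of r] w[of r'] r by (cases "w r' = w r") auto
    qed
    then have "coeff (g (c r)) (w r - 1) \<noteq> 0" using r h_diag by simp
    then have "g (c r) \<noteq> 0" by auto
    then have "finite {s. poly (g (c r)) s = 0}" by (rule poly_roots_finite)
    moreover have "infinite {0..1::real}" by (simp add: infinite_Icc)
    ultimately obtain s where s: "s \<in> {0..1}" "poly (g (c r)) s \<noteq> 0"
      by (metis (mono_tags, lifting) finite_subset mem_Collect_eq subsetI)
    have cont: "continuous_on {0..1} (\<lambda>s. (poly (g j) s)\<^sup>2)" for j
      by (intro continuous_intros)
    have nonneg: "?I j \<ge> 0" for j
      using int by (intro integral_nonneg) auto
    have "?I (c r) \<noteq> 0"
      using integral_eq_0_iff[OF cont] s by fastforce
    then have "0 < ?I (c r)" using nonneg[of "c r"] by simp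
    also have "\<dots> \<le> (\<Sum>j<k. ?I j)"
      using nonneg c[OF r(1)] by (intro member_le_sum) auto
    finally show ?thesis .
  qed
  finally show "0 < (\<Sum>r<n. \<Sum>r'<n. v $ r * v $ r' * mat n n (\<lambda>(r, r'). (\<Sum>j<k. h r j * h r' j) /
      real (w r + w r' - 1)) $$ (r, r'))" .
qed

section \<open>Determinants of matrices of power series\<close>

lemma has_fps_expansion_det:
  fixes Y :: "real \<Rightarrow> real mat"
  assumes Y: "\<And>t. Y t \<in> carrier_mat n n"
    and exp: "\<And>i j. i < n \<Longrightarrow> j < n \<Longrightarrow> (\<lambda>t. Y t $$ (i, j)) has_fps_expansion YF i j"
  shows "(\<lambda>t. det (Y t)) has_fps_expansion det (mat n n (\<lambda>(i, j). YF i j))"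
proof -
  have sign: "(signof p :: real fps) = fps_const (signof p)" for p :: "nat \<Rightarrow> nat"
    by (simp add: sign_def)
  have perm: "p i < n" if "p permutes {0..<n}" "i < n" for p i
    using permutes_in_image[OF that(1), of i] that(2) by simp
  have M: "mat n n (\<lambda>(i, j). YF i j) \<in> carrier_mat n n" by simp
  show ?thesis
    unfolding det_def'[OF Y] det_def'[OF M] sign
  proof (intro fps_expansion_intros)
    fix p i assume "p \<in> {p. p permutes {0..<n}}" "i \<in> {0..<n}"
    then show "(\<lambda>t. Y t $$ (i, p i)) has_fps_expansion mat n n (\<lambda>(i, j). YF i j) $$ (i, p i)"
      using exp perm by simp
  qed
qed

text \<open>A permutation \<open>p\<close> contributes the exponent obtained by summing
  \<open>w r + w (p r) - 1\<close>. Since \<open>p\<close> merely rearranges the weights, the sum is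
  the same for every \<open>p\<close>, and the power can be taken out of the Leibniz
  formula.\<close>

lemma det_fps_X_power_factor:
  fixes KF :: "nat \<Rightarrow> nat \<Rightarrow> real fps" and w :: "nat \<Rightarrow> nat"
  assumes w: "\<And>r. r < n \<Longrightarrow> 1 \<le> w r"
  shows "det (mat n n (\<lambda>(r, r'). fps_X ^ (w r + w r' - 1) * KF r r')) =
    fps_X ^ (\<Sum>r<n. 2 * w r - 1) * det (mat n n (\<lambda>(r, r'). KF r r'))"
proof -
  have M1: "mat n n (\<lambda>(r, r'). fps_X ^ (w r + w r' - 1) * KF r r') \<in> carrier_mat n n"
    and M2: "mat n n (\<lambda>(r, r'). KF r r') \<in> carrier_mat n n" by simp_all
  have "signof p * (\<Prod>r = 0..<n. mat n n (\<lambda>(r, r'). fps_X ^ (w r + w r' - 1) * KF r r') $$ (r, p r)) =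
      fps_X ^ (\<Sum>r<n. 2 * w r - 1) *
        (signof p * (\<Prod>r = 0..<n. mat n n (\<lambda>(r, r'). KF r r') $$ (r, p r)))"
    if p: "p permutes {0..<n}" for p
  proof -
    have pr: "p r < n" if "r < n" for r
      using permutes_in_image[OF p, of r] that by simp
    \<comment> \<open>Adding \<open>n\<close> to both sides, one for each summand, removes the
      truncated subtractions.\<close>
    have "(\<Sum>r = 0..<n. w r + w (p r) - 1) + n = (\<Sum>r = 0..<n. (w r + w (p r) - 1) + 1)"
      unfolding sum.distrib by simp
    also have "\<dots> = (\<Sum>r = 0..<n. w r + w (p r))"
      using w pr by (intro sum.cong refl) (auto simp: add_pos_pos Suc_le_eq)
    also have "\<dots> = (\<Sum>r = 0..<n. w r) + (\<Sum>r = 0..<n. w r)"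
      using sum.permute[OF p, of w] by (simp add: sum.distrib o_def)
    also have "\<dots> = (\<Sum>r = 0..<n. (2 * w r - 1) + 1)"
      unfolding sum.distrib[symmetric] using w by (intro sum.cong refl) fastforce
    also have "\<dots> = (\<Sum>r<n. 2 * w r - 1) + n"
      unfolding sum.distrib by (simp add: atLeast0LessThan)
    finally have "(\<Sum>r = 0..<n. w r + w (p r) - 1) = (\<Sum>r<n. 2 * w r - 1)" by simp
    then have "(\<Prod>r = 0..<n. fps_X ^ (w r + w (p r) - 1)) = (fps_X :: real fps) ^ (\<Sum>r<n. 2 * w r - 1)"
      by (simp add: power_sum[symmetric])
    moreover have "(\<Prod>r = 0..<n. mat n n (\<lambda>(r, r'). fps_X ^ (w r + w r' - 1) * KF r r') $$ (r, p r)) =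
        (\<Prod>r = 0..<n. fps_X ^ (w r + w (p r) - 1)) * (\<Prod>r = 0..<n. mat n n (\<lambda>(r, r'). KF r r') $$ (r, p r))"
      unfolding prod.distrib[symmetric] using pr by (intro prod.cong refl) simp
    ultimately show ?thesis by (simp add: mult_ac)
  qed
  then show ?thesis
    unfolding det_def'[OF M1] det_def'[OF M2] sum_distrib_left
    by (intro sum.cong refl) blast
qed

lemma fps_nth_0_det: "fps_nth (det M) 0 = det (map_mat (\<lambda>F. fps_nth F 0) (M :: real fps mat))"
proof -
  interpret comm_ring_hom "\<lambda>F :: real fps. fps_nth F 0"
    by unfold_locales auto
  show ?thesis by simp
qed

lemma fps_nth_integral0_Suc: "fps_nth (fps_integral0 F) (Suc l) = fps_nth F l / real (Suc l)"
  by (simp add: fps_integral_def divide_inverse mult.commute)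

lemma det_Dmat_fps_expansion:
  assumes A: "A \<in> carrier_mat n n" and B: "B \<in> carrier_mat n k" and k: "1 \<le> k"
    and kalman: "\<exists>m\<ge>1. mrank (kalman_mat A B m) = n"
  obtains F where "(\<lambda>t. det (Dmat A B t)) has_fps_expansion F"
    "\<And>i. i < homdim A B \<Longrightarrow> fps_nth F i = 0" "fps_nth F (homdim A B) > 0"
proof (rule kalman_adapted_basis[OF A B k kalman])
  fix S w c
  assume S: "S \<in> carrier_mat n n" and detS: "det S \<noteq> 0"
    and w: "\<And>r. r < n \<Longrightarrow> 1 \<le> w r" and c: "\<And>r. r < n \<Longrightarrow> c r < k"
    and zero: "\<And>r l j. r < n \<Longrightarrow> l < w r - 1 \<Longrightarrow> j < k \<Longrightarrow> (S * ((A ^\<^sub>m l) * B)) $$ (r, j) = 0"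
    and piv: "\<And>r r'. r < n \<Longrightarrow> r' < n \<Longrightarrow>
           (S * ((A ^\<^sub>m (w r - 1)) * B)) $$ (r', c r) = (if r' = r then 1 else 0)"
    and hom: "homdim A B = (\<Sum>r<n. 2 * w r - 1)"
  have dims [simp]: "dim_row S = n" "dim_col S = n" "dim_row B = n" "dim_col B = k"
    "dim_row A = n" "dim_col A = n"
    using S A B by auto
  \<comment> \<open>The Taylor series of the entries of \<open>SE t\<close> below. Its coefficients
    of index less than \<open>w r - 1\<close> vanish by \<open>zero\<close>, and \<open>H\<close> is
    the quotient by that power.\<close>
  define L where "L r j = Abs_fps (\<lambda>l. (S * ((A ^\<^sub>m l) * B)) $$ (r, j) / fact l)" for r j
  define H where "H r j = fps_shift (w r - 1) (L r j)" for r j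
  have LH: "L r j = fps_X ^ (w r - 1) * H r j" if "r < n" "j < k" for r j
    by (rule fps_ext) (use zero that in \<open>auto simp: H_def L_def fps_X_power_mult_nth\<close>)
  define SE where "SE t = S * (mexp (t \<cdot>\<^sub>m A) * B)" for t
  have SE: "(\<lambda>t. SE t $$ (r, j)) has_fps_expansion L r j" if rj: "r < n" "j < k" for r j
  proof -
    have E: "mexp (t \<cdot>\<^sub>m A) \<in> carrier_mat n n" for t using A by simp
    have Al: "A ^\<^sub>m l \<in> carrier_mat n n" for l using A by simp
    have "SE t $$ (r, j) = (\<Sum>a<n. S $$ (r, a) * (\<Sum>b<n. mexp (t \<cdot>\<^sub>m A) $$ (a, b) * B $$ (b, j)))" for t
      unfolding SE_def using index_mult_mat_sum[OF S mult_carrier_mat[OF E[of t] B] rj]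
      by (simp add: index_mult_mat_sum[OF E B] rj del: index_mult_mat(1))
    moreover have "(\<lambda>t. \<Sum>a<n. S $$ (r, a) * (\<Sum>b<n. mexp (t \<cdot>\<^sub>m A) $$ (a, b) * B $$ (b, j)))
        has_fps_expansion (\<Sum>a<n. fps_const (S $$ (r, a)) * (\<Sum>b<n. mexp_fps A a b * fps_const (B $$ (b, j))))"
      by (intro fps_expansion_intros mexp_has_fps_expansion[OF A]) auto
    moreover have "(\<Sum>a<n. fps_const (S $$ (r, a)) * (\<Sum>b<n. mexp_fps A a b * fps_const (B $$ (b, j)))) = L r j"
    proof (rule fps_ext)
      fix l
      have "(S * ((A ^\<^sub>m l) * B)) $$ (r, j) = (\<Sum>a<n. S $$ (r, a) * (\<Sum>b<n. (A ^\<^sub>m l) $$ (a, b) * B $$ (b, j)))"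
        using index_mult_mat_sum[OF S mult_carrier_mat[OF Al[of l] B] rj]
        by (simp add: index_mult_mat_sum[OF Al B] rj del: index_mult_mat(1))
      then show "fps_nth (\<Sum>a<n. fps_const (S $$ (r, a)) * (\<Sum>b<n. mexp_fps A a b * fps_const (B $$ (b, j)))) l =
          fps_nth (L r j) l"
        by (simp add: fps_sum_nth L_def mexp_fps_def sum_divide_distrib[symmetric])
    qed
    ultimately show ?thesis by simp
  qed
  define Y where "Y t = S * Dmat A B t * transpose_mat S" for t
  have dD [simp]: "dim_row (Dmat A B t) = n" "dim_col (Dmat A B t) = n" for t
    using Dmat_carrier[OF A B, of t] by auto
  have Y: "Y t \<in> carrier_mat n n" for t
    by (intro carrier_matI) (simp_all add: Y_def)
  \<comment> \<open>Integrating \<open>t ^ (l + w r + w r' - 2)\<close> raises the exponent by one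
    and divides by \<open>l + w r + w r' - 1\<close>; the power \<open>w r + w r' - 1\<close> is
    then taken out.\<close>
  define KF where "KF r r' = Abs_fps (\<lambda>l. fps_nth (\<Sum>j<k. H r j * H r' j) l / real (l + w r + w r' - 1))" for r r'
  have YF: "(\<lambda>t. Y t $$ (r, r')) has_fps_expansion fps_X ^ (w r + w r' - 1) * KF r r'"
    if r: "r < n" "r' < n" for r r'
  proof -
    have St: "transpose_mat S \<in> carrier_mat n n" using S by simp
    have SEc: "SE t \<in> carrier_mat n k" "transpose_mat (SE t) \<in> carrier_mat k n" for t
      by (auto simp: SE_def intro!: carrier_matI)
    have "transpose_mat (SE t) = transpose_mat B * transpose_mat (mexp (t \<cdot>\<^sub>m A)) * transpose_mat S" for t
    proof -
      have "mexp (t \<cdot>\<^sub>m A) \<in> carrier_mat n n" using A by simp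
      then show ?thesis
        unfolding SE_def using transpose_mult[OF S, of "mexp (t \<cdot>\<^sub>m A) * B" k] transpose_mult[of "mexp (t \<cdot>\<^sub>m A)" n n B k] B
        by simp
    qed
    \<comment> \<open>The congruence by \<open>S\<close> keeps the derivative a Gram matrix, now of
      the rows of \<open>SE t\<close>, whose orders in \<open>t\<close> are under control.\<close>
    then have rate: "S * gram_rate A B t * transpose_mat S = SE t * transpose_mat (SE t)" for t
      by (simp add: SE_def gram_rate_def mult_mat_assoc_dim)
    have "has_mat_derivative n n Y (S * gram_rate A B t * transpose_mat S) t" for t
      unfolding Y_def[abs_def]
      by (rule has_mat_derivative_mult_const[OF has_mat_derivative_const_mult[OF Dmat_has_derivative[OF A B] S] St])
    moreover have "(SE t * transpose_mat (SE t)) $$ (r, r') = (\<Sum>j<k. SE t $$ (r, j) * SE t $$ (r', j))" for t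
      using index_mult_mat_sum[OF SEc(1)[of t] SEc(2)[of t] r] SEc(1)[of t] r
      by (simp del: index_mult_mat(1))
    ultimately have "((\<lambda>t. Y t $$ (r, r')) has_real_derivative (\<Sum>j<k. SE t $$ (r, j) * SE t $$ (r', j))) (at t)" for t
      using r unfolding has_mat_derivative_def rate by metis
    moreover have "Y 0 $$ (r, r') = 0"
    proof -
      have "Dmat A B 0 = 0\<^sub>m n n"
        unfolding Dmat_eq_Gamma_int[OF A B] by (simp add: Gamma_int_0[OF A B]) (intro eq_matI, auto)
      then show ?thesis using r by (simp add: Y_def)
    qed
    moreover have "(\<lambda>t. \<Sum>j<k. SE t $$ (r, j) * SE t $$ (r', j)) has_fps_expansion (\<Sum>j<k. L r j * L r' j)"
      by (intro fps_expansion_intros SE r) auto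
    ultimately have "(\<lambda>t. Y t $$ (r, r')) has_fps_expansion fps_integral0 (\<Sum>j<k. L r j * L r' j)"
      by (intro has_fps_expansion_antiderivative) auto
    moreover have "(\<Sum>j<k. L r j * L r' j) = fps_X ^ (w r + w r' - 2) * (\<Sum>j<k. H r j * H r' j)"
    proof -
      have "(w r - 1) + (w r' - 1) = w r + w r' - 2" using w r by (metis Nat.add_diff_assoc Nat.add_diff_assoc2 diff_diff_add one_add_one)
      then have "fps_X ^ (w r - 1) * fps_X ^ (w r' - 1) = (fps_X :: real fps) ^ (w r + w r' - 2)"
        by (simp add: power_add[symmetric])
      then have "L r j * L r' j = fps_X ^ (w r + w r' - 2) * (H r j * H r' j)" if "j < k" for j
        using LH[OF r(1) that] LH[OF r(2) that] by (simp add: mult_ac) 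
      then show ?thesis by (simp add: sum_distrib_left)
    qed
    moreover have "fps_integral0 (fps_X ^ (w r + w r' - 2) * (\<Sum>j<k. H r j * H r' j)) =
        fps_X ^ (w r + w r' - 1) * KF r r'"
    proof (rule fps_ext)
      fix l
      show "fps_nth (fps_integral0 (fps_X ^ (w r + w r' - 2) * (\<Sum>j<k. H r j * H r' j))) l =
          fps_nth (fps_X ^ (w r + w r' - 1) * KF r r') l"
      proof (cases l)
        case 0
        then show ?thesis using w[OF r(1)] w[OF r(2)] by (simp add: fps_integral_def)
      next
        case (Suc l')
        define m where "m = w r + w r' - 2"
        have m: "w r + w r' - 1 = Suc m" "l + w r + w r' - 1 = l + Suc m" for l
          using w[OF r(1)] w[OF r(2)] by (auto simp: m_def)
        show ?thesis
          unfolding Suc fps_nth_integral0_Suc m_def[symmetric] KF_def m fps_X_power_mult_nth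
          by auto
      qed
    qed
    ultimately show ?thesis by simp
  qed
  define N where "N = homdim A B"
  define K where "K = det (mat n n (\<lambda>(r, r'). KF r r'))"
  have "(\<lambda>t. det (Y t)) has_fps_expansion det (mat n n (\<lambda>(r, r'). fps_X ^ (w r + w r' - 1) * KF r r'))"
    by (rule has_fps_expansion_det[OF Y YF])
  also have "det (mat n n (\<lambda>(r, r'). fps_X ^ (w r + w r' - 1) * KF r r')) = fps_X ^ N * K"
    unfolding N_def hom K_def by (rule det_fps_X_power_factor[OF w])
  finally have detY: "(\<lambda>t. det (Y t)) has_fps_expansion fps_X ^ N * K" .
  have K0: "fps_nth K 0 > 0"
  proof -
    \<comment> \<open>Only the term \<open>l = 0\<close> of each \<open>KF\<close> survives; this is
      the weighted Gram matrix of \<open>det_weighted_gram_pos\<close>, with the pivot positions as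
      \<open>c\<close>.\<close>
    have "fps_nth K 0 = det (mat n n (\<lambda>(r, r'). (\<Sum>j<k. fps_nth (H r j) 0 * fps_nth (H r' j) 0) / real (w r + w r' - 1)))"
      unfolding K_def fps_nth_0_det
      by (intro arg_cong[where f = det] eq_matI) (auto simp: KF_def fps_sum_nth)
    moreover have H0: "fps_nth (H r j) 0 = (S * ((A ^\<^sub>m (w r - 1)) * B)) $$ (r, j) / fact (w r - 1)" for r j
      by (simp add: H_def L_def)
    have "det (mat n n (\<lambda>(r, r'). (\<Sum>j<k. fps_nth (H r j) 0 * fps_nth (H r' j) 0) / real (w r + w r' - 1))) > 0"
    proof (rule det_weighted_gram_pos[where c = c])
      show "fps_nth (H r (c r)) 0 \<noteq> 0" if "r < n" for r
        unfolding H0 using piv[OF that that] by simp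
      show "fps_nth (H r' (c r)) 0 = 0" if "r < n" "r' < n" "r' \<noteq> r" "w r' = w r" for r r'
        unfolding H0 that(4) using piv[OF that(1,2)] that(3) by simp
    qed (use w c in auto)
    ultimately show ?thesis by simp
  qed
  have detY': "det (Y t) = det S * det S * det (Dmat A B t)" for t
  proof -
    have "S * Dmat A B t \<in> carrier_mat n n" "transpose_mat S \<in> carrier_mat n n" using S by (auto intro!: carrier_matI)
    then show ?thesis
      using det_mult[of "S * Dmat A B t" n "transpose_mat S"] det_mult[OF S Dmat_carrier[OF A B, of t]]
      by (simp add: Y_def det_transpose[OF S])
  qed
  \<comment> \<open>Undoes the congruence by \<open>S\<close>; its determinant enters squared, so
    the sign is kept.\<close>
  define C where "C = 1 / (det S * det S)"
  have C: "C > 0" using detS by (auto simp: C_def zero_less_mult_iff) 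
  have "(\<lambda>t. C * det (Y t)) has_fps_expansion fps_const C * (fps_X ^ N * K)"
    by (intro fps_expansion_intros detY)
  moreover have "C * det (Y t) = det (Dmat A B t)" for t
    using detS by (simp add: C_def detY')
  ultimately have "(\<lambda>t. det (Dmat A B t)) has_fps_expansion fps_const C * (fps_X ^ N * K)" by simp
  then show ?thesis
  proof (rule that)
    show "fps_nth (fps_const C * (fps_X ^ N * K)) i = 0" if "i < homdim A B" for i
      using that by (simp add: fps_X_power_mult_nth N_def)
    show "fps_nth (fps_const C * (fps_X ^ N * K)) (homdim A B) > 0"
      using K0 C by (simp add: fps_X_power_mult_nth N_def)
  qed
qed

section \<open>Expansion of the heat kernel\<close>

lemma eventually_at_0_reflect:
  fixes P :: "real \<Rightarrow> bool"
  assumes "\<forall>\<^sub>F t in at 0. P t"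
  shows "\<forall>\<^sub>F t in at 0. P (- t)"
proof -
  have "filterlim uminus (at (0::real)) (at 0)"
    by (intro filterlim_atI) (auto intro!: tendsto_eq_intros simp: eventually_at_filter)
  then show ?thesis using assms by (rule eventually_compose_filterlim[rotated])
qed

text \<open>Write \<open>f\<close> as \<open>t ^ N\<close> times a function that does not vanish at
  0. The power contributes the pole \<open>N / t\<close> to the logarithmic derivative, and the
  other factor contributes the analytic part \<open>W\<close>, which is U' / U.\<close>

lemma has_fps_expansion_log_derivative:
  fixes f \<beta> :: "real \<Rightarrow> real" and F :: "real fps" and N :: nat
  defines "U \<equiv> fps_shift N F"
  assumes f: "f has_fps_expansion F" and F: "\<And>i. i < N \<Longrightarrow> fps_nth F i = 0" "fps_nth F N \<noteq> 0"
    and deriv: "\<And>t. f t \<noteq> 0 \<Longrightarrow> (f has_real_derivative f t * \<beta> t) (at t)"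
  obtains W where "fps_conv_radius W > 0" "W * U = fps_deriv U"
    "\<forall>\<^sub>F t in at 0. f t \<noteq> 0 \<and> f t = t ^ N * eval_fps U t \<and> \<beta> t = real N / t + eval_fps W t"
proof -
  define W where "W = fps_deriv U * inverse U"
  have radU: "fps_conv_radius U > 0" using f by (simp add: U_def has_fps_expansion_def)
  have u: "eval_fps U has_fps_expansion U" by (rule eval_fps_has_fps_expansion[OF radU])
  have U0: "fps_nth U 0 \<noteq> 0" using F(2) by (simp add: U_def)
  have WU: "W * U = fps_deriv U"
    using U0 by (simp add: W_def mult.assoc inverse_mult_eq_1)
  have "(\<lambda>t. deriv (eval_fps U) t * inverse (eval_fps U t)) has_fps_expansion W"
    unfolding W_def by (intro fps_expansion_intros u U0)
  then have radW: "fps_conv_radius W > 0" by (simp add: has_fps_expansion_def)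
  have "F = fps_X ^ N * U"
    by (rule fps_ext) (use F(1) in \<open>auto simp: U_def fps_X_power_mult_nth\<close>)
  then have "(\<lambda>t. t ^ N * eval_fps U t) has_fps_expansion F"
    by (auto intro!: fps_expansion_intros u)
  with f have fu: "\<forall>\<^sub>F t in nhds 0. f t = t ^ N * eval_fps U t"
    by (auto simp: has_fps_expansion_def elim: eventually_elim2)
  have u0: "\<forall>\<^sub>F t in nhds 0. eval_fps U t \<noteq> 0"
    using U0 has_fps_expansion_imp_continuous[OF u, of UNIV]
    by (intro isCont_eventually_ne) (auto simp: eval_fps_at_0)
  have radii: "\<forall>\<^sub>F t in nhds 0. t \<in> eball 0 (fps_conv_radius U) \<and> t \<in> eball 0 (fps_conv_radius W)"
    using radU radW
    by (intro eventually_conj eventually_nhds_in_open) (auto simp: zero_ereal_def)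
  \<comment> \<open>Differentiating at \<open>t\<close> requires the factorisation on a
    neighbourhood of \<open>t\<close>, not only at \<open>t\<close>.\<close>
  have "\<forall>\<^sub>F t in nhds 0. (\<forall>\<^sub>F s in nhds t. f s = s ^ N * eval_fps U s) \<and> eval_fps U t \<noteq> 0 \<and>
      t \<in> eball 0 (fps_conv_radius U) \<and> t \<in> eball 0 (fps_conv_radius W)"
    using u0 radii fu[THEN eventually_eventually[THEN iffD2]] by eventually_elim blast
  then have "\<forall>\<^sub>F t in at 0. f t \<noteq> 0 \<and> f t = t ^ N * eval_fps U t \<and> \<beta> t = real N / t + eval_fps W t"
    unfolding eventually_at_filter
  proof eventually_elim
    case (elim t)
    show ?case
    proof (intro impI)
      assume t: "t \<noteq> 0"
      let ?u = "eval_fps U t" and ?w = "eval_fps W t"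
      have ft: "f t = t ^ N * ?u" using elim eventually_nhds_x_imp_x by blast
      then have f0: "f t \<noteq> 0" using t elim by simp
      have "eval_fps (fps_deriv U) t = ?w * ?u"
        unfolding WU[symmetric] using elim by (intro eval_fps_mult) auto
      then have "(eval_fps U has_real_derivative ?w * ?u) (at t)"
        using has_field_derivative_eval_fps[of t U UNIV] elim by auto
      then have "((\<lambda>s. s ^ N * eval_fps U s) has_real_derivative
          real N * t ^ (N - 1) * ?u + ?w * ?u * t ^ N) (at t)"
        by (auto intro!: derivative_eq_intros)
      moreover have "real N * t ^ (N - 1) * ?u + ?w * ?u * t ^ N = f t * (real N / t + ?w)"
        using t by (cases N) (auto simp: ft field_simps)
      ultimately have "(f has_real_derivative f t * (real N / t + ?w)) (at t)"
        using DERIV_cong_ev[OF refl _ refl, of f "\<lambda>s. s ^ N * eval_fps U s"] elim by simp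
      then have "f t * \<beta> t = f t * (real N / t + ?w)"
        using deriv[OF f0] DERIV_unique by blast
      then have "\<beta> t = real N / t + ?w" using f0 by simp
      with f0 ft show "f t \<noteq> 0 \<and> f t = t ^ N * ?u \<and> \<beta> t = real N / t + ?w" by blast
    qed
  qed
  with radW WU show ?thesis by (rule that)
qed

text \<open>The hypothesis says that the even part of \<open>W\<close> is the constant
  \<open>c\<close>. A function that is zero on a punctured neighbourhood of 0 is of every order
  there, so all coefficients of the difference vanish.\<close>

lemma fps_nth_of_reflection:
  fixes W :: "real fps"
  assumes rad: "fps_conv_radius W > 0"
    and refl: "\<forall>\<^sub>F t in at 0. eval_fps W t + eval_fps W (- t) = 2 * c"
  shows "fps_nth W 0 = c" "0 < l \<Longrightarrow> even l \<Longrightarrow> fps_nth W l = 0"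
proof -
  let ?R = "W + Abs_fps (\<lambda>n. (- 1) ^ n * fps_nth W n) - fps_const (2 * c)"
  have W: "eval_fps W has_fps_expansion W" by (rule eval_fps_has_fps_expansion[OF rad])
  have "(\<lambda>t. eval_fps W t + eval_fps W (- t) - 2 * c) has_fps_expansion ?R"
    by (intro fps_expansion_intros has_fps_expansion_reflect W)
  moreover have "(\<lambda>t. eval_fps W t + eval_fps W (- t) - 2 * c) \<in> O[at 0](\<lambda>t. t ^ m)" for m
    using refl by (intro bigoI[where c = 0]) (auto elim: eventually_mono)
  ultimately have R: "fps_nth ?R l = 0" for l
    by (rule fps_nth_eq_0_of_bigo) (rule lessI)
  show "fps_nth W 0 = c" using R[of 0] by simp
  show "fps_nth W l = 0" if "0 < l" "even l" using R[of l] that by simp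
qed

lemma mtrace_Qmat_expansion:
  assumes B: "B \<in> carrier_mat n k" and Q: "Q_expansion A B Ic Qc"
  shows "(\<lambda>t. mtrace (Qmat A B t) - mtrace Ic / t\<^sup>2 - (\<Sum>l\<le>h. mtrace (Qc l) * t ^ l))
    \<in> O[at 0](\<lambda>t. t ^ (h + 1))"
proof -
  have k: "dim_col B = k" using B by simp
  have tr: "mtrace Ic = (\<Sum>i<k. Ic $$ (i, i))" "mtrace (Qc l) = (\<Sum>i<k. Qc l $$ (i, i))"
    "mtrace (Qmat A B t) = (\<Sum>i<k. Qmat A B t $$ (i, i))" for l t
  proof -
    have "dim_row Ic = k" "dim_row (Qc l) = k" using Q k by (auto simp: Q_expansion_def)
    then show "mtrace Ic = (\<Sum>i<k. Ic $$ (i, i))" "mtrace (Qc l) = (\<Sum>i<k. Qc l $$ (i, i))"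
      "mtrace (Qmat A B t) = (\<Sum>i<k. Qmat A B t $$ (i, i))"
      using k by (simp_all add: mtrace_def Qmat_def)
  qed
  have "(\<lambda>t. \<Sum>i<k. Qmat A B t $$ (i, i) - Ic $$ (i, i) / t\<^sup>2 - (\<Sum>l\<le>h. Qc l $$ (i, i) * t ^ l))
      \<in> O[at 0](\<lambda>t. t ^ (h + 1))"
    using Q unfolding Q_expansion_def k by (intro big_sum_in_bigo) auto
  moreover have "(\<Sum>i<k. Qmat A B t $$ (i, i) - Ic $$ (i, i) / t\<^sup>2 - (\<Sum>l\<le>h. Qc l $$ (i, i) * t ^ l)) =
      mtrace (Qmat A B t) - mtrace Ic / t\<^sup>2 - (\<Sum>l\<le>h. mtrace (Qc l) * t ^ l)" for t
    unfolding tr by (simp add: sum_subtractf sum_divide_distrib sum_distrib_right sum.swap[of _ "{..h}"])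
  ultimately show ?thesis by simp
qed

text \<open>The derivative in the form \<open>mexp (t \<cdot>\<^sub>m A) * A\<close> kills
  \<open>x\<close>, so its orbit is constant. Hence the exponent of the kernel vanishes on the
  diagonal at \<open>x\<close>.\<close>

lemma mexp_mult_kernel_vec:
  assumes A: "A \<in> carrier_mat n n" and x: "x \<in> carrier_vec n" and Ax: "A *\<^sub>v x = 0\<^sub>v n"
  shows "mexp (t \<cdot>\<^sub>m A) *\<^sub>v x = x"
proof (rule eq_vecI)
  let ?E = "\<lambda>t. mexp (t \<cdot>\<^sub>m A)"
  have E: "?E t \<in> carrier_mat n n" for t using A by simp
  have idx: "(M *\<^sub>v x) $ i = (\<Sum>j<n. M $$ (i, j) * x $ j)" if "M \<in> carrier_mat n n" "i < n" for M i
    using that x by (simp add: scalar_prod_def atLeast0LessThan)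
  fix i assume "i < dim_vec x"
  then have i: "i < n" using x by simp
  have "((\<lambda>t. \<Sum>j<n. ?E t $$ (i, j) * x $ j) has_real_derivative 0) (at t)" for t
  proof -
    have "((\<lambda>t. \<Sum>j<n. ?E t $$ (i, j) * x $ j) has_real_derivative
        (\<Sum>j<n. (?E t * A) $$ (i, j) * x $ j)) (at t)"
      using mexp_has_derivative(2)[OF A, of t] i
      by (intro DERIV_sum DERIV_cmult_right) (auto simp: has_mat_derivative_def)
    also have "(\<Sum>j<n. (?E t * A) $$ (i, j) * x $ j) = (?E t * A *\<^sub>v x) $ i"
      by (rule idx[symmetric]) (use A E i in auto)
    also have "?E t * A *\<^sub>v x = ?E t *\<^sub>v 0\<^sub>v n"
      using assoc_mult_mat_vec[OF E A x] by (simp only: Ax)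
    also have "(?E t *\<^sub>v 0\<^sub>v n) $ i = 0"
      using A i by (auto simp: scalar_prod_def)
    finally show ?thesis .
  qed
  then have "(\<Sum>j<n. ?E t $$ (i, j) * x $ j) = (\<Sum>j<n. ?E 0 $$ (i, j) * x $ j)"
    using DERIV_isconst_all[of "\<lambda>t. \<Sum>j<n. ?E t $$ (i, j) * x $ j"] by blast
  then have "(?E t *\<^sub>v x) $ i = (?E 0 *\<^sub>v x) $ i"
    by (simp only: idx[OF E i])
  then show "(?E t *\<^sub>v x) $ i = x $ i" using x by (simp add: mexp_0[OF A])
qed (use A x in simp)

lemma heat_kernel_diagonal:
  assumes A: "A \<in> carrier_mat n n" and B: "B \<in> carrier_mat n k" and x: "x \<in> carrier_vec n"
    and Ax: "A *\<^sub>v x = 0\<^sub>v n" and d: "det (Dmat A B t) \<noteq> 0"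
  shows "heat_kernel A B t x x = 1 / ((2 * pi) powr (real n / 2) * sqrt (det (Dmat A B t)))"
proof -
  have G: "minv (Dmat A B t) \<in> carrier_mat n n" by (rule minv(1)[OF Dmat_carrier[OF A B] d])
  have z: "x - mexp (t \<cdot>\<^sub>m A) *\<^sub>v x = 0\<^sub>v n"
    using x by (simp add: mexp_mult_kernel_vec[OF A x Ax])
  have "minv (Dmat A B t) *\<^sub>v 0\<^sub>v n \<in> carrier_vec n" using G by simp
  then have "0\<^sub>v n \<bullet> (minv (Dmat A B t) *\<^sub>v 0\<^sub>v n) = 0" by (rule scalar_prod_left_zero)
  then show ?thesis using A by (simp add: heat_kernel_def Let_def z)
qed

text \<open>\<open>Q_expansion\<close> determines every coefficient of \<open>W\<close> except the constant one, which comes from the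
  symmetry \<open>det_Dmat_reflect\<close>. The symmetry also makes \<open>W\<close> minus its constant term odd, so the sign
  \<open>(- 1) ^ l\<close> is immaterial; it is the one in the closed formula for \<open>a 3\<close>.\<close>
lemma log_derivative_coeffs:
  assumes A: "A \<in> carrier_mat n n" and B: "B \<in> carrier_mat n k"
    and rad: "fps_conv_radius W > 0" and f0: "\<forall>\<^sub>F t in at 0. det (Dmat A B t) \<noteq> 0"
    and \<beta>: "\<forall>\<^sub>F t in at 0. mtrace (transpose_mat B * minv (Gamma_int A B t) * B) = real N / t + eval_fps W t"
    and Q: "Q_expansion A B Ic Qc"
  shows "fps_nth W 0 = mtrace A" "fps_nth W (Suc l) = - ((- 1) ^ l * mtrace (Qc l) / real (Suc l))"
proof -
  let ?f = "\<lambda>t. det (Dmat A B t)"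
  let ?\<beta> = "\<lambda>t. mtrace (transpose_mat B * minv (Gamma_int A B t) * B)"
  let ?\<tau> = "mtrace A"
  note df = det_Dmat_has_derivative[OF A B]
  \<comment> \<open>Logarithmic differentiation of \<open>det_Dmat_reflect\<close>; the chain rule
    supplies the sign that turns a difference into a sum.\<close>
  have sym: "?\<beta> t + ?\<beta> (- t) = 2 * ?\<tau>" if "?f t \<noteq> 0" "?f (- t) \<noteq> 0" for t
  proof -
    have "((\<lambda>s. (- 1) ^ n * exp (2 * s * ?\<tau>) * ?f (- s)) has_real_derivative
        (- 1) ^ n * (exp (2 * t * ?\<tau>) * (2 * ?\<tau>)) * ?f (- t) +
        (?f (- t) * ?\<beta> (- t) * (- 1)) * ((- 1) ^ n * exp (2 * t * ?\<tau>))) (at t)"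
      by (intro DERIV_mult DERIV_cmult DERIV_chain2[where f = ?f and g = uminus] df that)
        (auto intro!: derivative_eq_intros)
    also have "(\<lambda>s. (- 1) ^ n * exp (2 * s * ?\<tau>) * ?f (- s)) = ?f"
      by (rule ext) (rule det_Dmat_reflect[OF A B, symmetric])
    also have "(- 1) ^ n * (exp (2 * t * ?\<tau>) * (2 * ?\<tau>)) * ?f (- t) +
        (?f (- t) * ?\<beta> (- t) * (- 1)) * ((- 1) ^ n * exp (2 * t * ?\<tau>)) =
        ((- 1) ^ n * exp (2 * t * ?\<tau>) * ?f (- t)) * (2 * ?\<tau> - ?\<beta> (- t))"
      by (simp add: algebra_simps)
    also have "(- 1) ^ n * exp (2 * t * ?\<tau>) * ?f (- t) = ?f t"
      by (rule det_Dmat_reflect[OF A B, symmetric])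
    finally have "?f t * ?\<beta> t = ?f t * (2 * ?\<tau> - ?\<beta> (- t))"
      using df[OF that(1)] DERIV_unique by blast
    then show ?thesis using that(1) by simp
  qed
  \<comment> \<open>The pole \<open>N / t\<close> is odd and cancels.\<close>
  have "\<forall>\<^sub>F t in at 0. eval_fps W t + eval_fps W (- t) = 2 * ?\<tau>"
    using f0 \<beta> eventually_at_0_reflect[OF f0] eventually_at_0_reflect[OF \<beta>]
  proof eventually_elim
    case (elim t)
    then show ?case using sym[of t] by simp
  qed
  note W = fps_nth_of_reflection[OF rad this]
  show "fps_nth W 0 = mtrace A" by (rule W(1))
  have ev: "\<forall>\<^sub>F t in at 0. mtrace (Qmat A B t) = - eval_fps (fps_deriv W) t + real N / t\<^sup>2"
  proof -
    have open_nhds: "\<forall>\<^sub>F t in nhds 0. t \<in> eball 0 (fps_conv_radius W)"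
      using rad by (intro eventually_nhds_in_open) (auto simp: zero_ereal_def)
    \<comment> \<open>To differentiate at \<open>t\<close>, the identity must hold around
      \<open>t\<close>: an open set without 0 is a neighbourhood of each of its remaining
      points.\<close>
    have "\<forall>\<^sub>F t in at 0. (\<forall>\<^sub>F s in nhds t. ?\<beta> s = real N / s + eval_fps W s)"
    proof -
      obtain S where S: "open S" "0 \<in> S" "\<And>s. s \<in> S \<Longrightarrow> s \<noteq> 0 \<Longrightarrow> ?\<beta> s = real N / s + eval_fps W s"
        using \<beta> unfolding eventually_at_topological by blast
      have "\<forall>\<^sub>F s in nhds t. ?\<beta> s = real N / s + eval_fps W s" if "t \<in> S" "t \<noteq> 0" for t
        using S that unfolding eventually_nhds by (intro exI[of _ "S - {0}"]) auto
      then show ?thesis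
        unfolding eventually_at_topological using S(1,2) by blast
    qed
    moreover have "\<forall>\<^sub>F t in at 0. t \<in> eball 0 (fps_conv_radius W) \<and> t \<noteq> 0"
      using open_nhds by (auto simp: eventually_at_filter elim: eventually_mono)
    ultimately show ?thesis using f0
    proof eventually_elim
      case (elim t)
      have "det (Gamma_int A B t) \<noteq> 0"
        using elim det_Dmat_eq_det_Gamma[OF A B, of t] by auto
      note d\<beta> = mtrace_Qmat_derivative[OF A B this]
      have "(eval_fps W has_real_derivative eval_fps (fps_deriv W) t) (at t)"
        using elim by (intro has_field_derivative_eval_fps) auto
      then have "((\<lambda>s. real N / s + eval_fps W s) has_real_derivative
          - (real N / t\<^sup>2) + eval_fps (fps_deriv W) t) (at t)"
        using elim by (auto intro!: derivative_eq_intros simp: power2_eq_square)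
      then have "(?\<beta> has_real_derivative - (real N / t\<^sup>2) + eval_fps (fps_deriv W) t) (at t)"
        using DERIV_cong_ev[OF refl elim(1) refl] by blast
      then have "- mtrace (Qmat A B t) = - (real N / t\<^sup>2) + eval_fps (fps_deriv W) t"
        using d\<beta> DERIV_unique by blast
      then show ?case by simp
    qed
  qed
  have "(\<lambda>t. - eval_fps (fps_deriv W) t + (real N - mtrace Ic) / t\<^sup>2 - (\<Sum>l\<le>h. mtrace (Qc l) * t ^ l))
      \<in> O[at 0](\<lambda>t. t ^ (h + 1))" for h
  proof -
    have "\<forall>\<^sub>F t in at 0. mtrace (Qmat A B t) - mtrace Ic / t\<^sup>2 - (\<Sum>l\<le>h. mtrace (Qc l) * t ^ l) =
        - eval_fps (fps_deriv W) t + (real N - mtrace Ic) / t\<^sup>2 - (\<Sum>l\<le>h. mtrace (Qc l) * t ^ l)"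
      using ev by eventually_elim (simp add: diff_divide_distrib)
    from landau_o.big.in_cong[OF this] show ?thesis
      using mtrace_Qmat_expansion[OF B Q] by blast
  qed
  moreover have "(\<lambda>t. - eval_fps (fps_deriv W) t) has_fps_expansion - fps_deriv W"
  proof -
    have "fps_conv_radius (fps_deriv W) > 0" using rad fps_conv_radius_deriv[of W] by (rule less_le_trans)
    then show ?thesis by (intro fps_expansion_intros eval_fps_has_fps_expansion)
  qed
  ultimately have q: "fps_nth (- fps_deriv W) l = mtrace (Qc l)" for l
    using laurent_expansion_unique[of _ _ "real N - mtrace Ic" "\<lambda>l. mtrace (Qc l)"] by blast
  show "fps_nth W (Suc l) = - ((- 1) ^ l * mtrace (Qc l) / real (Suc l))"
  \<comment> \<open>For odd \<open>l\<close> both sides are zero: \<open>Suc l\<close> is even and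
    positive, so the coefficient of \<open>W\<close> vanishes, and \<open>q\<close> carries this
    over to the trace of \<open>Qc l\<close>.\<close>
  proof (cases "even l")
    case True
    then show ?thesis using q[of l] by (simp add: field_simps del: of_nat_Suc)
  next
    case False
    then have "fps_nth W (Suc l) = 0" using W(2)[of "Suc l"] by simp
    then show ?thesis using q[of l] by simp
  qed
qed

theorem theorem1:
  "\<exists>P :: nat \<Rightarrow> mpoly.
     (\<forall>i. mpoly_total_degree (P i) = i \<and> mpoly_vars (P i) \<subseteq> {..<i}) \<and>
     (\<forall>(n::nat) (k::nat) (A::real mat) (B::real mat).
        1 \<le> n \<and> 1 \<le> k \<and> k \<le> n \<and>
        A \<in> carrier_mat n n \<and> B \<in> carrier_mat n k \<and> mrank B = k \<and>
        (\<exists>m\<ge>1. mrank (kalman_mat A B m) = n)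
        \<longrightarrow>
        (\<exists>c0 > 0.
           ((\<lambda>t. det (Dmat A B t) / t ^ homdim A B) \<longlongrightarrow> c0) (at_right 0) \<and>
           (\<forall>Ic Qc. Q_expansion A B Ic Qc \<longrightarrow>
              (let a = (\<lambda>i. mpoly_eval (P i)
                              (\<lambda>v. if v = 0 then mtrace A else mtrace (Qc (v - 1))))
               in a 0 = 1 \<and>
                  a 1 = - mtrace A / 2 \<and>
                  a 2 = (mtrace A)^2 / 8 + mtrace (Qc 0) / 4 \<and>
                  a 3 = - mtrace (Qc 1) / 12 - mtrace A * mtrace (Qc 0) / 8 - (mtrace A)^3 / 48 \<and>
                  (\<forall>x0 \<in> carrier_vec n. A *\<^sub>v x0 = 0\<^sub>v n \<longrightarrow>
                     (\<forall>h::nat.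
                        (\<lambda>t. heat_kernel A B t x0 x0 * ((2 * pi) powr (real n / 2) * sqrt c0)
                               * t powr (real (homdim A B) / 2)
                             - (\<Sum>i\<le>h. a i * t ^ i))
                        \<in> O[at_right 0](\<lambda>t. t ^ (h + 1))))))))"
proof (intro exI[of _ heat_poly] conjI allI impI total_degree_heat_poly vars_heat_poly)
  fix n k :: nat and A B :: "real mat"
  assume "1 \<le> n \<and> 1 \<le> k \<and> k \<le> n \<and>
        A \<in> carrier_mat n n \<and> B \<in> carrier_mat n k \<and> mrank B = k \<and>
        (\<exists>m\<ge>1. mrank (kalman_mat A B m) = n)"
  then have A: "A \<in> carrier_mat n n" and B: "B \<in> carrier_mat n k" and k: "1 \<le> k"
    and kalman: "\<exists>m\<ge>1. mrank (kalman_mat A B m) = n" by auto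
  define N where "N = homdim A B"
  obtain F where f: "(\<lambda>t. det (Dmat A B t)) has_fps_expansion F"
    and F: "\<And>i. i < N \<Longrightarrow> fps_nth F i = 0" and c0: "fps_nth F N > 0"
    using det_Dmat_fps_expansion[OF A B k kalman] unfolding N_def by metis
  \<comment> \<open>The constant term of \<open>U\<close> is the limit \<open>c0\<close>.\<close>
  define U where "U = fps_shift N F"
  have FN: "fps_nth F N \<noteq> 0" using c0 by simp
  obtain W where W: "fps_conv_radius W > 0" "W * U = fps_deriv U"
    and ev: "\<forall>\<^sub>F t in at 0. det (Dmat A B t) \<noteq> 0 \<and> det (Dmat A B t) = t ^ N * eval_fps U t \<and>
      mtrace (transpose_mat B * minv (Gamma_int A B t) * B) = real N / t + eval_fps W t"
    using has_fps_expansion_log_derivative[OF f F FN det_Dmat_has_derivative[OF A B]]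
    unfolding U_def by blast
  have radU: "fps_conv_radius U > 0" using f by (simp add: U_def has_fps_expansion_def)
  have at_right_le: "at_right (0::real) \<le> at 0" by (simp add: at_le)
  show "\<exists>c0 > 0.
           ((\<lambda>t. det (Dmat A B t) / t ^ homdim A B) \<longlongrightarrow> c0) (at_right 0) \<and>
           (\<forall>Ic Qc. Q_expansion A B Ic Qc \<longrightarrow>
              (let a = (\<lambda>i. mpoly_eval (heat_poly i)
                              (\<lambda>v. if v = 0 then mtrace A else mtrace (Qc (v - 1))))
               in a 0 = 1 \<and>
                  a 1 = - mtrace A / 2 \<and>
                  a 2 = (mtrace A)^2 / 8 + mtrace (Qc 0) / 4 \<and>
                  a 3 = - mtrace (Qc 1) / 12 - mtrace A * mtrace (Qc 0) / 8 - (mtrace A)^3 / 48 \<and>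
                  (\<forall>x0 \<in> carrier_vec n. A *\<^sub>v x0 = 0\<^sub>v n \<longrightarrow>
                     (\<forall>h::nat.
                        (\<lambda>t. heat_kernel A B t x0 x0 * ((2 * pi) powr (real n / 2) * sqrt c0)
                               * t powr (real (homdim A B) / 2)
                             - (\<Sum>i\<le>h. a i * t ^ i))
                        \<in> O[at_right 0](\<lambda>t. t ^ (h + 1))))))"
    unfolding N_def[symmetric]
  proof (intro exI[of _ "fps_nth F N"] conjI c0 allI impI)
    show "((\<lambda>t. det (Dmat A B t) / t ^ N) \<longlongrightarrow> fps_nth F N) (at_right 0)"
      using has_fps_expansion_tendsto_coeff[OF f F] by (rule tendsto_mono[OF at_right_le])
    fix Ic Qc assume Q: "Q_expansion A B Ic Qc"
    \<comment> \<open>The point \<open>x0\<close> does not enter here, so the coefficients cannot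
      depend on it.\<close>
    define x where "x = (\<lambda>v. if v = 0 then mtrace A else mtrace (Qc (v - 1)))"
    define a where "a i = mpoly_eval (heat_poly i) x" for i
    have f0: "\<forall>\<^sub>F t in at 0. det (Dmat A B t) \<noteq> 0"
      and \<beta>: "\<forall>\<^sub>F t in at 0. mtrace (transpose_mat B * minv (Gamma_int A B t) * B) =
        real N / t + eval_fps W t"
      using ev by (auto elim: eventually_mono)
    note coeffs = log_derivative_coeffs[OF A B W(1) f0 \<beta> Q]
    \<comment> \<open>This is what \<open>log_coeff\<close> was made for: \<open>- 1 / 2\<close> is
      the exponent of the determinant in the kernel, and the division by \<open>j\<close> comes from
      integrating the trace of \<open>Qmat\<close> to obtain \<open>W\<close>.\<close>
    have log_coeff: "log_coeff j * x j = - 1 / 2 * fps_nth W j" for j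
      by (cases j) (auto simp: log_coeff_def x_def coeffs field_simps simp del: of_nat_Suc)
    have "(\<lambda>t. sqrt (fps_nth U 0 / eval_fps U t)) has_fps_expansion Abs_fps a"
    proof (rule has_fps_expansion_inverse_sqrt[OF radU W(1) _ W(2)])
      show "fps_nth U 0 > 0" using c0 by (simp add: U_def)
      show "a 0 = 1" by (simp add: a_def)
      show "real (Suc i) * a (Suc i) = (\<Sum>j\<le>i. - 1 / 2 * fps_nth W j * a (i - j))" for i
        unfolding a_def mpoly_eval_heat_poly_Suc log_coeff ..
    qed
    then have "(\<lambda>t. sqrt (fps_nth F N / eval_fps U t)) has_fps_expansion Abs_fps a"
      by (simp add: U_def)
    from has_fps_expansion_bigo[OF this]
    have expansion: "(\<lambda>t. sqrt (fps_nth F N / eval_fps U t) - (\<Sum>i\<le>h. a i * t ^ i))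
        \<in> O[at_right 0](\<lambda>t. t ^ (h + 1))" for h
      using landau_o.big.filter_mono[OF at_right_le] by fastforce
    have main: "(\<lambda>t. heat_kernel A B t x0 x0 * ((2 * pi) powr (real n / 2) * sqrt (fps_nth F N))
          * t powr (real N / 2) - (\<Sum>i\<le>h. a i * t ^ i)) \<in> O[at_right 0](\<lambda>t. t ^ (h + 1))"
      if x0: "x0 \<in> carrier_vec n" "A *\<^sub>v x0 = 0\<^sub>v n" for x0 h
    proof -
      have "\<forall>\<^sub>F t in at_right 0. 0 < (t::real)"
        by (simp add: eventually_at_right_less)
      moreover have "\<forall>\<^sub>F t in at_right 0. det (Dmat A B t) \<noteq> 0 \<and> det (Dmat A B t) = t ^ N * eval_fps U t"
        using filter_leD[OF at_right_le ev] by eventually_elim auto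
      ultimately have "\<forall>\<^sub>F t in at_right 0.
          heat_kernel A B t x0 x0 * ((2 * pi) powr (real n / 2) * sqrt (fps_nth F N)) * t powr (real N / 2)
          - (\<Sum>i\<le>h. a i * t ^ i) = sqrt (fps_nth F N / eval_fps U t) - (\<Sum>i\<le>h. a i * t ^ i)"
      proof eventually_elim
        case (elim t)
        have "sqrt (t ^ N) = t powr (real N / 2)"
          using elim by (simp add: powr_half_sqrt[symmetric] powr_realpow[symmetric] powr_powr)
        then have "sqrt (det (Dmat A B t)) = t powr (real N / 2) * sqrt (eval_fps U t)"
          using elim by (simp add: real_sqrt_mult)
        moreover have "1 / (b * (p * s)) * (b * c) * p = c / s" if "b \<noteq> 0" "p \<noteq> 0" for b p c s :: real
          using that by (cases "s = 0") (auto simp: field_simps)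
        ultimately show ?case
          using elim(1) heat_kernel_diagonal[OF A B x0 elim(2)[THEN conjunct1]]
          by (simp add: real_sqrt_divide)
      qed
      from landau_o.big.in_cong[OF this] show ?thesis using expansion by blast
    qed
    show "let a = (\<lambda>i. mpoly_eval (heat_poly i) (\<lambda>v. if v = 0 then mtrace A else mtrace (Qc (v - 1))))
       in a 0 = 1 \<and> a 1 = - mtrace A / 2 \<and>
          a 2 = (mtrace A)^2 / 8 + mtrace (Qc 0) / 4 \<and>
          a 3 = - mtrace (Qc 1) / 12 - mtrace A * mtrace (Qc 0) / 8 - (mtrace A)^3 / 48 \<and>
          (\<forall>x0 \<in> carrier_vec n. A *\<^sub>v x0 = 0\<^sub>v n \<longrightarrow>
             (\<forall>h::nat.
                (\<lambda>t. heat_kernel A B t x0 x0 * ((2 * pi) powr (real n / 2) * sqrt (fps_nth F N))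
                       * t powr (real N / 2) - (\<Sum>i\<le>h. a i * t ^ i))
                \<in> O[at_right 0](\<lambda>t. t ^ (h + 1))))"
      unfolding Let_def x_def[symmetric] mpoly_eval_heat_poly_explicit
      using main by (simp add: a_def x_def)
  qed
qed

end
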